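(* Let $X$ be a compact complex manifold of complex dimension $n$. Then, for any $k\in\mathbb{Z}$, $$ h^k_{A} \;\leq\; \min\{k+1,\,(2n-k)+1\}\,\left(h^k_{\overline\partial}+h^{k+1}_{\overline\partial}\right) \;\leq\; (n+1)\,\left(h^k_{\overline\partial}+h^{k+1}_{\overline\partial}\right), $$ and also $$ h^k_{BC} \;\leq\; \min\{k+1,\,(2n-k)+1\}\,\left(h^k_{\overline\partial}+h^{k-1}_{\overline\partial}\right) \;\leq\; (n+1)\,\left(h^k_{\overline\partial}+h^{k-1}_{\overline\partial}\right). $$
   Context: For a compact complex manifold $X$, let $(\wedge^{\bullet,\bullet}X,\partial,\overline\partial)$ be the double complex of smooth complex-valued differential forms, bigraded by type $(p,q)$. Define the Dolbeault, Bott-Chern and Aeppli cohomologies (all bigraded, taken in each bidegree $(p,q)$, and all finite-dimensional) by $$ H^{\bullet,\bullet}_{\overline\partial}(X)=\frac{\ker\overline\partial}{\mathrm{im}\,\overline\partial},\qquad H^{\bullet,\bullet}_{BC}(X)=\frac{\ker\partial\cap\ker\overline\partial}{\mathrm{im}\,\partial\overline\partial},\qquad H^{\bullet,\bullet}_{A}(X)=\frac{\ker\partial\overline\partial}{\mathrm{im}\,\partial+\mathrm{im}\,\overline\partial}. $$ For $\sharp\in\{\overline\partial,BC,A\}$ and $k\in\mathbb{Z}$, set $h^k_{\sharp}:=\sum_{p+q=k}\dim_{\mathbb{C}}H^{p,q}_{\sharp}(X)$ (which is zero for $k<0$ or $k>2n$). *)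

theory Defs
  imports "HOL-Analysis.Analysis"
begin

section \<open>Calculus on open subsets of \<open>\<complex>\<^sup>n\<close>\<close>

text \<open>Coordinates are indexed by a finite set \<open>I\<close>, so that the dimension is \<open>n = card I\<close>. The model
  space \<open>\<complex>\<^sup>I\<close> is realised as a coordinate subspace of \<^typ>\<open>complex^'i\<close> instead of the whole type because
  the whole type never has dimension 0. All of what follows takes place on sets that are open
  \<^emph>\<open>relative to\<close> this subspace.\<close>

definition cspace :: "'i set \<Rightarrow> (complex^'i::finite) set" where
  "cspace I = {z. \<forall>i. i \<notin> I \<longrightarrow> z $ i = 0}"

text \<open>\<open>C\<^sup>k\<close> in the real sense. On a set \<open>S\<close> that is open in \<open>cspace I\<close>, the derivative within \<open>S\<close> is
  determined on \<open>cspace I\<close> only; its values on other vectors carry no information.\<close>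

primrec Ck_on :: "nat \<Rightarrow> 'a::real_normed_vector set \<Rightarrow> ('a \<Rightarrow> 'b::real_normed_vector) \<Rightarrow> bool" where
  "Ck_on 0 S f \<longleftrightarrow> continuous_on S f"
| "Ck_on (Suc k) S f \<longleftrightarrow>
     (\<exists>f'. (\<forall>x\<in>S. (f has_derivative f' x) (at x within S)) \<and> (\<forall>v. Ck_on k S (\<lambda>x. f' x v)))"

definition smooth_on :: "'a::real_normed_vector set \<Rightarrow> ('a \<Rightarrow> 'b::real_normed_vector) \<Rightarrow> bool" where
  "smooth_on S f \<longleftrightarrow> (\<forall>k. Ck_on k S f)"

text \<open>A map is holomorphic if it is smooth and its differential is complex linear
  (the Cauchy--Riemann equations).\<close>

definition holomorphic_map_on :: "(complex^'i::finite) set \<Rightarrow> (complex^'i \<Rightarrow> complex^'i) \<Rightarrow> bool" where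
  "holomorphic_map_on S F \<longleftrightarrow> smooth_on S F \<and>
     (\<forall>z\<in>S. \<exists>L. (F has_derivative L) (at z within S) \<and> (\<forall>c v. L (c *s v) = c *s L v))"

definition dir_deriv :: "('a::real_normed_vector \<Rightarrow> 'b::real_normed_vector) \<Rightarrow> 'a \<Rightarrow> 'a \<Rightarrow> 'b" where
  "dir_deriv f z v = vector_derivative (\<lambda>t. f (z + t *\<^sub>R v)) (at 0)"

text \<open>The Wirtinger derivatives \<open>\<partial>/\<partial>z\<^sub>j = (\<partial>/\<partial>x\<^sub>j - \<i> \<partial>/\<partial>y\<^sub>j)/2\<close> and
  \<open>\<partial>/\<partial>zbar\<^sub>j = (\<partial>/\<partial>x\<^sub>j + \<i> \<partial>/\<partial>y\<^sub>j)/2\<close>.\<close>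

definition d_dz :: "'i \<Rightarrow> (complex^'i::finite \<Rightarrow> complex) \<Rightarrow> complex^'i \<Rightarrow> complex" where
  "d_dz j f z = (dir_deriv f z (axis j 1) - \<i> * dir_deriv f z (axis j \<i>)) / 2"

definition d_dzbar :: "'i \<Rightarrow> (complex^'i::finite \<Rightarrow> complex) \<Rightarrow> complex^'i \<Rightarrow> complex" where
  "d_dzbar j f z = (dir_deriv f z (axis j 1) + \<i> * dir_deriv f z (axis j \<i>)) / 2"


section \<open>Compact complex manifolds\<close>

text \<open>A chart is a pair of its domain and its coordinate map.\<close>

type_synonym ('a, 'i) chart = "'a set \<times> ('a \<Rightarrow> complex^'i)"

abbreviation chart_range :: "('a, 'i::finite) chart \<Rightarrow> (complex^'i) set" where
  "chart_range c \<equiv> snd c ` fst c"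

definition is_chart :: "'i set \<Rightarrow> 'a topology \<Rightarrow> ('a, 'i::finite) chart \<Rightarrow> bool" where
  "is_chart I X c \<longleftrightarrow> openin X (fst c) \<and>
     openin (top_of_set (cspace I)) (chart_range c) \<and>
     homeomorphic_map (subtopology X (fst c)) (top_of_set (chart_range c)) (snd c)"

definition transition :: "('a, 'i::finite) chart \<Rightarrow> ('a, 'i) chart \<Rightarrow> complex^'i \<Rightarrow> complex^'i" where
  "transition c d = snd d \<circ> inv_into (fst c) (snd c)"

text \<open>\<open>A\<close> is a holomorphic atlas, not necessarily maximal. Second countability is automatic for a
  compact space covered by charts. Connectedness is not required.\<close>

definition compact_complex_manifold ::
  "'i set \<Rightarrow> 'a topology \<Rightarrow> ('a, 'i::finite) chart set \<Rightarrow> bool" where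
  "compact_complex_manifold I X A \<longleftrightarrow>
     compact_space X \<and> Hausdorff_space X \<and>
     (\<forall>c\<in>A. is_chart I X c) \<and> (\<Union>c\<in>A. fst c) = topspace X \<and>
     (\<forall>c\<in>A. \<forall>d\<in>A. holomorphic_map_on (snd c ` (fst c \<inter> fst d)) (transition c d))"


section \<open>Smooth forms of type \<open>(p,q)\<close>\<close>

text \<open>Complex-valued \<open>k\<close>-covectors are functions of a list of vectors that vanish on lists of length
  different from \<open>k\<close>. The wedge product of the 1-covectors \<open>\<theta>\<^sub>i\<close> is
  \<open>(v\<^sub>j)\<^sub>j \<mapsto> det (\<theta>\<^sub>i(v\<^sub>j))\<^sub>i\<^sub>j\<close>.\<close>

definition wedge :: "('v \<Rightarrow> complex) list \<Rightarrow> 'v list \<Rightarrow> complex" where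
  "wedge \<theta>s vs =
     (if length vs = length \<theta>s
      then \<Sum>\<pi> | \<pi> permutes {..<length \<theta>s}.
             of_int (sign \<pi>) * (\<Prod>i<length \<theta>s. (\<theta>s ! i) (vs ! \<pi> i))
      else 0)"

definition dz :: "'i \<Rightarrow> complex^'i::finite \<Rightarrow> complex" where
  "dz i v = v $ i"

definition dzbar :: "'i \<Rightarrow> complex^'i::finite \<Rightarrow> complex" where
  "dzbar i v = cnj (v $ i)"

definition pq_monomials :: "'i set \<Rightarrow> int \<Rightarrow> int \<Rightarrow> ((complex^'i::finite) list \<Rightarrow> complex) set" where
  "pq_monomials I p q =
     {wedge (map dz is @ map dzbar js) | is js.
        set is \<subseteq> I \<and> set js \<subseteq> I \<and> int (length is) = p \<and> int (length js) = q}"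

text \<open>The complex span of the \<open>dz\<^sub>i \<and> \<dots> \<and> dzbar\<^sub>j \<and> \<dots>\<close>; it is zero if \<open>p < 0\<close> or \<open>q < 0\<close>.\<close>

definition pq_covectors :: "'i set \<Rightarrow> int \<Rightarrow> int \<Rightarrow> ((complex^'i::finite) list \<Rightarrow> complex) set" where
  "pq_covectors I p q =
     {\<alpha>. \<exists>B a. finite B \<and> B \<subseteq> pq_monomials I p q \<and> \<alpha> = (\<lambda>vs. \<Sum>\<beta>\<in>B. a \<beta> * \<beta> vs)}"

text \<open>A form on the manifold is the family of its local expressions in the charts of the atlas:
  \<open>\<omega> c z\<close> is its value at the point with coordinates \<open>z\<close> in the chart \<open>c\<close>. The local expressions are
  exchanged by pullback along the transition maps. Since arguments outside the chart ranges are
  meaningless, \<open>\<omega>\<close> is required to vanish there, so that equal forms are equal as functions.\<close>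

type_synonym ('a, 'i) form = "('a, 'i) chart \<Rightarrow> complex^'i \<Rightarrow> (complex^'i) list \<Rightarrow> complex"

definition forms ::
  "'i set \<Rightarrow> ('a, 'i::finite) chart set \<Rightarrow> int \<Rightarrow> int \<Rightarrow> ('a, 'i) form set" where
  "forms I A p q = {\<omega>.
     (\<forall>c\<in>A. \<forall>z\<in>chart_range c. \<omega> c z \<in> pq_covectors I p q) \<and>
     (\<forall>c\<in>A. \<forall>vs. smooth_on (chart_range c) (\<lambda>z. \<omega> c z vs)) \<and>
     (\<forall>c\<in>A. \<forall>d\<in>A. \<forall>x\<in>fst c \<inter> fst d. \<forall>vs. set vs \<subseteq> cspace I \<longrightarrow>
        \<omega> c (snd c x) vs = \<omega> d (snd d x) (map (dir_deriv (transition c d) (snd c x)) vs)) \<and>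
     (\<forall>c z vs. \<not> (c \<in> A \<and> z \<in> chart_range c) \<longrightarrow> \<omega> c z vs = 0)}"

text \<open>In a chart, \<open>\<partial>\<omega> = \<Sum>\<^sub>i dz\<^sub>i \<and> \<partial>\<omega>/\<partial>z\<^sub>i\<close>, the derivative being taken coefficientwise, and the
  wedge with the 1-form \<open>dz\<^sub>i\<close> on the left is expanded as
  \<open>(dz\<^sub>i \<and> \<alpha>)(v\<^sub>0,\<dots>,v\<^sub>k) = \<Sum>\<^sub>j (-1)\<^sup>j dz\<^sub>i(v\<^sub>j) \<alpha>(v\<^sub>0,\<dots>,v\<^sub>j\<^sub>-\<^sub>1,v\<^sub>j\<^sub>+\<^sub>1,\<dots>,v\<^sub>k)\<close>.
  Likewise for the conjugate operator.\<close>

definition del :: "'i set \<Rightarrow> ('a, 'i::finite) chart set \<Rightarrow> ('a, 'i) form \<Rightarrow> ('a, 'i) form" where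
  "del I A \<omega> = (\<lambda>c z vs.
     if c \<in> A \<and> z \<in> chart_range c
     then \<Sum>j<length vs. (-1) ^ j *
            (\<Sum>i\<in>I. dz i (vs ! j) * d_dz i (\<lambda>w. \<omega> c w (take j vs @ drop (Suc j) vs)) z)
     else 0)"

definition delbar :: "'i set \<Rightarrow> ('a, 'i::finite) chart set \<Rightarrow> ('a, 'i) form \<Rightarrow> ('a, 'i) form" where
  "delbar I A \<omega> = (\<lambda>c z vs.
     if c \<in> A \<and> z \<in> chart_range c
     then \<Sum>j<length vs. (-1) ^ j *
            (\<Sum>i\<in>I. dzbar i (vs ! j) * d_dzbar i (\<lambda>w. \<omega> c w (take j vs @ drop (Suc j) vs)) z)
     else 0)"


section \<open>Cohomology\<close>

abbreviation zero_form :: "('a, 'i::finite) form" where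
  "zero_form \<equiv> (\<lambda>c z vs. 0)"

text \<open>The dimension of the complex vector space \<open>Z/W\<close>, for subspaces \<open>W \<subseteq> Z\<close>: the supremum of the
  cardinalities of finite subsets of \<open>Z\<close> that are linearly independent modulo \<open>W\<close>. It is \<open>\<infinity>\<close> exactly
  if \<open>Z/W\<close> is infinite-dimensional.\<close>

definition quot_dim :: "('a, 'i::finite) form set \<Rightarrow> ('a, 'i) form set \<Rightarrow> enat" where
  "quot_dim Z W =
     (SUP B \<in> {B. finite B \<and> B \<subseteq> Z \<and>
                 (\<forall>a. (\<lambda>c z vs. \<Sum>\<omega>\<in>B. a \<omega> * \<omega> c z vs) \<in> W \<longrightarrow> (\<forall>\<omega>\<in>B. a \<omega> = 0))}.
        enat (card B))"

definition dim_Dolbeault :: "'i set \<Rightarrow> ('a, 'i::finite) chart set \<Rightarrow> int \<Rightarrow> int \<Rightarrow> enat" where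
  "dim_Dolbeault I A p q = quot_dim
     {\<omega> \<in> forms I A p q. delbar I A \<omega> = zero_form}
     (delbar I A ` forms I A p (q - 1))"

definition dim_BottChern :: "'i set \<Rightarrow> ('a, 'i::finite) chart set \<Rightarrow> int \<Rightarrow> int \<Rightarrow> enat" where
  "dim_BottChern I A p q = quot_dim
     {\<omega> \<in> forms I A p q. del I A \<omega> = zero_form \<and> delbar I A \<omega> = zero_form}
     ((\<lambda>\<eta>. del I A (delbar I A \<eta>)) ` forms I A (p - 1) (q - 1))"

definition dim_Aeppli :: "'i set \<Rightarrow> ('a, 'i::finite) chart set \<Rightarrow> int \<Rightarrow> int \<Rightarrow> enat" where
  "dim_Aeppli I A p q = quot_dim
     {\<omega> \<in> forms I A p q. del I A (delbar I A \<omega>) = zero_form}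
     {(\<lambda>c z vs. del I A \<eta> c z vs + delbar I A \<zeta> c z vs) | \<eta> \<zeta>.
        \<eta> \<in> forms I A (p - 1) q \<and> \<zeta> \<in> forms I A p (q - 1)}"

text \<open>The sums over all \<open>(p,q)\<close> with \<open>p + q = k\<close>, where \<open>p, q \<ge> 0\<close>. They are extended reals so that
  they can be multiplied by possibly negative integers.\<close>

definition h_Dolbeault :: "'i set \<Rightarrow> ('a, 'i::finite) chart set \<Rightarrow> int \<Rightarrow> ereal" where
  "h_Dolbeault I A k = ereal_of_enat (\<Sum>p=0..k. dim_Dolbeault I A p (k - p))"

definition h_BottChern :: "'i set \<Rightarrow> ('a, 'i::finite) chart set \<Rightarrow> int \<Rightarrow> ereal" where
  "h_BottChern I A k = ereal_of_enat (\<Sum>p=0..k. dim_BottChern I A p (k - p))"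

definition h_Aeppli :: "'i set \<Rightarrow> ('a, 'i::finite) chart set \<Rightarrow> int \<Rightarrow> ereal" where
  "h_Aeppli I A k = ereal_of_enat (\<Sum>p=0..k. dim_Aeppli I A p (k - p))"

end

theory Submission
  imports Defs "HOL-Library.Function_Algebras" "Jordan_Normal_Form.Determinant"
begin

text \<open>Write \<open>d\<close> and \<open>d'\<close> for \<open>\<partial>\<close> and its conjugate. In any double complex, the classes of
  \<open>d x\<close> and, if \<open>d x = d' y\<close>, of \<open>y\<close> measure how far an Aeppli class \<open>[x]\<close> in bidegree \<open>(p,q)\<close> is
  from zero: if \<open>y = d u + d' v\<close>, then \<open>x + d' u\<close> is \<open>d\<close>-closed. This gives
  \<open>h\<^sub>A(p,q) \<le> h\<^sub>d\<^sub>'(p+1,q) + h\<^sub>A(p+1,q-1) + h\<^sub>d(p,q)\<close>, and in the same way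
  \<open>h\<^sub>B\<^sub>C(p,q) \<le> h\<^sub>d\<^sub>'(p,q) + h\<^sub>B\<^sub>C(p+1,q-1) + h\<^sub>d(p,q-1)\<close>. Iterating until \<open>q < 0\<close> bounds each
  summand of \<open>h\<^sub>A\<close> or \<open>h\<^sub>B\<^sub>C\<close> in total degree \<open>k\<close> by numbers \<open>h\<^sub>d\<^sub>'\<close> in one of the two total degrees and numbers
  \<open>h\<^sub>d\<close> in the other. Complex conjugation turns \<open>h\<^sub>d(p,q)\<close> into \<open>h\<^sub>d\<^sub>'(q,p)\<close>, and the number of
  nonzero summands is \<open>min {k + 1, 2n - k + 1}\<close>.\<close>

section \<open>Dimensions of quotients and double complexes\<close>

text \<open>The inequalities are pure algebra of a double complex. The obstacle is to show that
  families of local expressions form one. The operators are given by coordinate formulas, so their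
  compatibility with transition maps must be proved. This becomes tractable with
  \<open>wirtinger\<close>, the complex-linear or antilinear part of the differential in a
  direction: what remains is a product rule and the cancellation of Hessian terms. Also, covectors
  of type (p,q) are spanned by linearly dependent monomials, so a form has no canonical coefficients
  to differentiate; evaluation at finitely many arguments replaces them.

  Dimensions are suprema of sizes of independent families. Accordingly, an embedding of quotients is
  expressed as a relation that carries independent families along, and each three-term estimate
  comes from a chain of subspaces whose successive quotients embed in the three cohomologies.

  The iteration runs along an antidiagonal, so the bidegrees it meets are pairwise distinct, and
  each summand costs at most one full total in each of two degrees. Hence the factor counts summands
  and not iterations.\<close>

locale quotient_dimension = vector_space scale
  for scale :: "'a::field \<Rightarrow> 'b::ab_group_add \<Rightarrow> 'b"
begin

definition independent_mod :: "'b set \<Rightarrow> 'b set \<Rightarrow> bool" where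
  "independent_mod W B \<longleftrightarrow> finite B \<and> (\<forall>a. (\<Sum>x\<in>B. scale (a x) x) \<in> W \<longrightarrow> (\<forall>x\<in>B. a x = 0))"

definition qdim :: "'b set \<Rightarrow> 'b set \<Rightarrow> enat" where
  "qdim Z W = (SUP B \<in> {B. B \<subseteq> Z \<and> independent_mod W B}. enat (card B))"

lemma card_le_qdim: "B \<subseteq> Z \<Longrightarrow> independent_mod W B \<Longrightarrow> enat (card B) \<le> qdim Z W"
  unfolding qdim_def by (rule SUP_upper) simp

lemma qdim_leI:
  "(\<And>B. B \<subseteq> Z \<Longrightarrow> independent_mod W B \<Longrightarrow> enat (card B) \<le> m) \<Longrightarrow> qdim Z W \<le> m"
  unfolding qdim_def by (rule SUP_least) simp

lemma qdim_zero:
  assumes "Z \<subseteq> {0}" "0 \<in> W" shows "qdim Z W = 0"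
proof -
  have "card B = 0" if B: "B \<subseteq> Z" "independent_mod W B" for B
  proof -
    have "(\<Sum>x\<in>B. scale 1 x) = 0" using B(1) assms(1) by (intro sum.neutral) auto
    with B(2)[unfolded independent_mod_def, THEN conjunct2, rule_format, of "\<lambda>_. 1"] assms(2)
    have "B = {}" by auto
    then show ?thesis by simp
  qed
  then have "qdim Z W \<le> 0" by (intro qdim_leI) (simp add: zero_enat_def)
  then show ?thesis by simp
qed

text \<open>The twist \<open>\<tau>\<close> allows for relations that are semilinear, such as complex conjugation.\<close>

lemma qdim_le_relation:
  assumes ex: "\<And>x. x \<in> Z \<Longrightarrow> \<exists>y\<in>Z'. R x y"
    and R0: "R 0 0"
    and Radd: "\<And>x y x' y'. R x y \<Longrightarrow> R x' y' \<Longrightarrow> R (x + x') (y + y')"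
    and Rscale: "\<And>a x y. R x y \<Longrightarrow> R (scale (\<tau> a) x) (scale a y)"
    and \<tau>: "\<And>a. \<tau> a = 0 \<Longrightarrow> a = 0" "\<tau> 0 = 0"
    and RW: "\<And>x y. R x y \<Longrightarrow> y \<in> W' \<Longrightarrow> x \<in> W"
    and W': "0 \<in> W'"
  shows "qdim Z W \<le> qdim Z' W'"
proof (rule qdim_leI)
  fix B assume B: "B \<subseteq> Z" "independent_mod W B"
  then have fin: "finite B" by (simp add: independent_mod_def)
  have indep: "\<forall>x\<in>B. a x = 0" if "(\<Sum>x\<in>B. scale (a x) x) \<in> W" for a
    using B(2) that by (simp add: independent_mod_def)
  \<comment> \<open>The relation plays the role of an injection from
    \<open>Z\<close>/\<open>W\<close> to \<open>Z'\<close>/\<open>W'\<close>, defined only up to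
    choices. Any choice of partners serves, because combinations of partners are again
    related.\<close>
  obtain r where r: "\<And>x. x \<in> B \<Longrightarrow> r x \<in> Z' \<and> R x (r x)"
    using ex B(1) by (metis subsetD)
  have Rsum: "R (\<Sum>x\<in>C. scale (\<tau> (a x)) x) (\<Sum>x\<in>C. scale (a x) (r x))" if "C \<subseteq> B" for C a
    using finite_subset[OF that fin] that
    by (induction C rule: finite_induct) (auto intro!: R0 Radd Rscale simp: r)
  have key: "\<forall>x\<in>B. a x = 0" if "(\<Sum>x\<in>B. scale (a x) (r x)) \<in> W'" for a
    using indep[OF RW[OF Rsum[OF order_refl] that]] \<tau>(1) by blast
  have inj: "inj_on r B"
  proof (rule inj_onI, rule ccontr)
    fix x y assume xy: "x \<in> B" "y \<in> B" "r x = r y" "x \<noteq> y"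
    \<comment> \<open>Two elements with the same partner would give a nontrivial relation between
      partners, with coefficients 1 and -1.\<close>
    let ?a = "\<lambda>z. if z = x then 1 else if z = y then -1 else 0"
    have "(\<Sum>z\<in>B. scale (?a z) (r z)) = (\<Sum>z\<in>{x,y}. scale (?a z) (r z))"
      using xy fin by (intro sum.mono_neutral_right) auto
    also have "\<dots> = 0" using xy by simp
    finally have "(\<Sum>z\<in>B. scale (?a z) (r z)) \<in> W'" using W' by metis
    with key[OF this] xy(1) show False by force
  qed
  have "independent_mod W' (r ` B)"
    unfolding independent_mod_def
  proof (intro conjI allI impI)
    show "finite (r ` B)" using fin by simp
    fix a assume "(\<Sum>y\<in>r ` B. scale (a y) y) \<in> W'"
    then have "(\<Sum>x\<in>B. scale (a (r x)) (r x)) \<in> W'" by (simp add: sum.reindex inj)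
    from key[OF this] show "\<forall>y\<in>r ` B. a y = 0" by simp
  qed
  then have "enat (card (r ` B)) \<le> qdim Z' W'" using r by (intro card_le_qdim) auto
  then show "enat (card B) \<le> qdim Z' W'" by (simp add: card_image inj)
qed

text \<open>Basis extension: a maximal part of \<open>B\<close> that is independent modulo
  \<open>K\<close> is counted by the first term. The remaining elements, corrected by that part,
  fall into \<open>K\<close> and stay independent modulo \<open>W\<close>.\<close>

lemma qdim_trans_le:
  assumes K: "subspace K" and W: "0 \<in> W"
  shows "qdim Z W \<le> qdim Z K + qdim K W"
proof (rule qdim_leI)
  fix B assume B: "B \<subseteq> Z" "independent_mod W B"
  then have fin: "finite B" by (simp add: independent_mod_def)
  have indep: "\<forall>x\<in>B. a x = 0" if "(\<Sum>x\<in>B. scale (a x) x) \<in> W" for a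
    using B(2) that by (simp add: independent_mod_def)
  define P where "P = (\<lambda>C. C \<subseteq> B \<and> independent_mod K C)"
  have "P {}" by (simp add: P_def independent_mod_def)
  then obtain C where C: "P C" and max: "\<And>D. P D \<Longrightarrow> card D \<le> card C"
    using ex_has_greatest_nat[of P "{}" card "Suc (card B)"] fin
    by (auto simp: P_def less_Suc_eq_le card_mono)
  have CB: "C \<subseteq> B" and Cind: "independent_mod K C" and finC: "finite C"
    using C by (auto simp: P_def independent_mod_def)
  \<comment> \<open>By maximality, adding b creates a dependence modulo \<open>K\<close>. Since
    \<open>C\<close> alone has none, b occurs in it with a nonzero coefficient and can be solved
    for.\<close>
  have "\<exists>c. b - (\<Sum>x\<in>C. scale (c x) x) \<in> K" if b: "b \<in> B - C" for b
  proof -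
    have "\<not> P (insert b C)" using max[of "insert b C"] b finC by auto
    then obtain a where a: "(\<Sum>x\<in>insert b C. scale (a x) x) \<in> K" "\<exists>x\<in>insert b C. a x \<noteq> 0"
      using b CB finC by (auto simp: P_def independent_mod_def)
    have s: "(\<Sum>x\<in>insert b C. scale (a x) x) = scale (a b) b + (\<Sum>x\<in>C. scale (a x) x)"
      using b finC by simp
    have ab: "a b \<noteq> 0"
    proof
      assume 0: "a b = 0"
      then have "(\<Sum>x\<in>C. scale (a x) x) \<in> K" using a(1) s by simp
      then show False using Cind a(2) 0 unfolding independent_mod_def by auto
    qed
    have "scale (inverse (a b)) (scale (a b) b + (\<Sum>x\<in>C. scale (a x) x)) \<in> K"
      using a(1) s K by (simp add: subspace_scale)
    moreover have "scale (inverse (a b)) (scale (a b) b + (\<Sum>x\<in>C. scale (a x) x))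
       = b - (\<Sum>x\<in>C. scale (- inverse (a b) * a x) x)"
      using ab by (simp add: scale_right_distrib scale_sum_right sum_negf)
    ultimately show ?thesis by metis
  qed
  then obtain c where c: "\<And>b. b \<in> B - C \<Longrightarrow> b - (\<Sum>x\<in>C. scale (c b x) x) \<in> K"
    by metis
  define r where "r b = b - (\<Sum>x\<in>C. scale (c b x) x)" for b
  have key: "\<forall>b\<in>B - C. a b = 0" if "(\<Sum>b\<in>B - C. scale (a b) (r b)) \<in> W" for a
  proof -
    \<comment> \<open>The coefficients of the given combination of residues, rewritten as a
      combination of the original elements of \<open>B\<close>.\<close>
    define e where "e x = (if x \<in> C then - (\<Sum>b\<in>B - C. a b * c b x) else a x)" for x
    have "(\<Sum>b\<in>B - C. scale (a b) (r b)) = (\<Sum>b\<in>B - C. scale (a b) b)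
        - (\<Sum>b\<in>B - C. \<Sum>x\<in>C. scale (a b * c b x) x)"
      by (simp add: r_def scale_right_diff_distrib sum_subtractf scale_sum_right)
    also have "(\<Sum>b\<in>B - C. \<Sum>x\<in>C. scale (a b * c b x) x) = (\<Sum>x\<in>C. scale (\<Sum>b\<in>B - C. a b * c b x) x)"
      by (subst sum.swap) (simp add: scale_sum_left)
    also have "(\<Sum>b\<in>B - C. scale (a b) b) - \<dots> = (\<Sum>x\<in>B - C. scale (e x) x) + (\<Sum>x\<in>C. scale (e x) x)"
      by (simp add: e_def sum_negf)
    also have "\<dots> = (\<Sum>x\<in>B. scale (e x) x)"
      using CB fin by (metis sum.subset_diff)
    finally have "\<forall>x\<in>B. e x = 0" using that indep by simp
    then show ?thesis by (auto simp: e_def)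
  qed
  have inj: "inj_on r (B - C)"
  proof (rule inj_onI, rule ccontr)
    fix x y assume xy: "x \<in> B - C" "y \<in> B - C" "r x = r y" "x \<noteq> y"
    let ?a = "\<lambda>z. if z = x then 1 else if z = y then -1 else 0"
    have "(\<Sum>z\<in>B - C. scale (?a z) (r z)) = (\<Sum>z\<in>{x,y}. scale (?a z) (r z))"
      using xy fin by (intro sum.mono_neutral_right) auto
    also have "\<dots> = 0" using xy by simp
    finally have "(\<Sum>z\<in>B - C. scale (?a z) (r z)) \<in> W" using W by metis
    with key[OF this] xy(1) show False by force
  qed
  have "independent_mod W (r ` (B - C))"
    unfolding independent_mod_def
  proof (intro conjI allI impI)
    show "finite (r ` (B - C))" using fin by simp
    fix a assume "(\<Sum>y\<in>r ` (B - C). scale (a y) y) \<in> W"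
    then have "(\<Sum>x\<in>B - C. scale (a (r x)) (r x)) \<in> W" by (simp add: sum.reindex inj)
    from key[OF this] show "\<forall>y\<in>r ` (B - C). a y = 0" by simp
  qed
  then have "enat (card (r ` (B - C))) \<le> qdim K W"
    using c by (intro card_le_qdim) (auto simp: r_def)
  moreover have "enat (card C) \<le> qdim Z K" using CB B(1) Cind by (intro card_le_qdim) auto
  moreover have "card B = card C + card (r ` (B - C))"
    using CB fin by (simp add: card_image[OF inj] card_Diff_subset finC card_mono)
  ultimately show "enat (card B) \<le> qdim Z K + qdim K W"
    by (metis add_mono plus_enat_simps(1))
qed
end

section \<open>Double complexes and the one-step estimates\<close>

locale double_complex = quotient_dimension scale
  for scale :: "'a::field \<Rightarrow> 'b::ab_group_add \<Rightarrow> 'b" +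
  fixes A :: "int \<Rightarrow> int \<Rightarrow> 'b set" and d d' :: "'b \<Rightarrow> 'b"
  assumes subspace_A: "subspace (A p q)"
    and d_in: "x \<in> A p q \<Longrightarrow> d x \<in> A (p + 1) q"
    and d'_in: "x \<in> A p q \<Longrightarrow> d' x \<in> A p (q + 1)"
    and d_add: "x \<in> A p q \<Longrightarrow> y \<in> A p q \<Longrightarrow> d (x + y) = d x + d y"
    and d'_add: "x \<in> A p q \<Longrightarrow> y \<in> A p q \<Longrightarrow> d' (x + y) = d' x + d' y"
    and d_scale: "x \<in> A p q \<Longrightarrow> d (scale a x) = scale a (d x)"
    and d'_scale: "x \<in> A p q \<Longrightarrow> d' (scale a x) = scale a (d' x)"
    and d_d: "x \<in> A p q \<Longrightarrow> d (d x) = 0"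
    and d'_d': "x \<in> A p q \<Longrightarrow> d' (d' x) = 0"
    and d'_d: "x \<in> A p q \<Longrightarrow> d' (d x) = - d (d' x)"
begin

definition h_d :: "int \<Rightarrow> int \<Rightarrow> enat" where
  "h_d p q = qdim {x \<in> A p q. d x = 0} (d ` A (p - 1) q)"

definition h_d' :: "int \<Rightarrow> int \<Rightarrow> enat" where
  "h_d' p q = qdim {x \<in> A p q. d' x = 0} (d' ` A p (q - 1))"

definition h_BC :: "int \<Rightarrow> int \<Rightarrow> enat" where
  "h_BC p q = qdim {x \<in> A p q. d x = 0 \<and> d' x = 0} ((\<lambda>y. d (d' y)) ` A (p - 1) (q - 1))"

definition h_A :: "int \<Rightarrow> int \<Rightarrow> enat" where
  "h_A p q = qdim {x \<in> A p q. d (d' x) = 0} {d y + d' z | y z. y \<in> A (p - 1) q \<and> z \<in> A p (q - 1)}"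

lemma zero_in: "0 \<in> A p q"
  and add_in: "x \<in> A p q \<Longrightarrow> y \<in> A p q \<Longrightarrow> x + y \<in> A p q"
  and scale_in: "x \<in> A p q \<Longrightarrow> scale a x \<in> A p q"
  and uminus_in: "x \<in> A p q \<Longrightarrow> - x \<in> A p q"
  and diff_in: "x \<in> A p q \<Longrightarrow> y \<in> A p q \<Longrightarrow> x - y \<in> A p q"
  using subspace_A[of p q] by (auto simp: subspace_0 subspace_add subspace_scale subspace_neg subspace_diff)

lemma d_zero: "d 0 = 0" and d'_zero: "d' 0 = 0"
  using d_add[OF zero_in zero_in] d'_add[OF zero_in zero_in] by auto

lemma d_uminus: "x \<in> A p q \<Longrightarrow> d (- x) = - d x"
  and d'_uminus: "x \<in> A p q \<Longrightarrow> d' (- x) = - d' x"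
  using d_scale[of x p q "- 1"] d'_scale[of x p q "- 1"] by auto

lemma d_diff: "x \<in> A p q \<Longrightarrow> y \<in> A p q \<Longrightarrow> d (x - y) = d x - d y"
  and d'_diff: "x \<in> A p q \<Longrightarrow> y \<in> A p q \<Longrightarrow> d' (x - y) = d' x - d' y"
  using d_add[of x p q "- y"] d'_add[of x p q "- y"] by (auto simp: uminus_in d_uminus d'_uminus)

lemma d_in': "x \<in> A (p - 1) q \<Longrightarrow> d x \<in> A p q" and d'_in': "x \<in> A p (q - 1) \<Longrightarrow> d' x \<in> A p q"
  using d_in[of x "p - 1" q] d'_in[of x p "q - 1"] by auto

lemmas A_closed = zero_in add_in scale_in uminus_in diff_in d_in d'_in d_in' d'_in'

text \<open>The cocycles \<open>?Z\<close> are filtered by \<open>?K\<close>, then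
  \<open>?K'\<close>, then the boundaries \<open>?B\<close>. The successive quotients embed by
  sending x to \<open>d x\<close>, to the y with \<open>d x = d' y\<close>, and to
  \<open>x + d' u\<close>.\<close>

lemma Aeppli_step: "h_A p q \<le> h_d' (p + 1) q + h_A (p + 1) (q - 1) + h_d p q"
proof -
  let ?Z = "\<lambda>p q. {x \<in> A p q. d (d' x) = 0}"
  let ?B = "\<lambda>p q. {d y + d' z | y z. y \<in> A (p - 1) q \<and> z \<in> A p (q - 1)}"
  let ?K = "{x \<in> ?Z p q. \<exists>y\<in>A (p + 1) (q - 1). d x = d' y}"
  \<comment> \<open>Exactly the elements of \<open>?K\<close> that have a partner y of zero Aeppli
    class, that is, \<open>y = d u + d' v\<close>.\<close>
  let ?K' = "{x \<in> ?Z p q. \<exists>y\<in>A (p + 1) (q - 1) \<inter> ?B (p + 1) (q - 1). d x = d' y}"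
  have subB: "subspace (?B p q)" for p q
  proof (rule subspaceI)
    have "0 = d 0 + d' 0" by (simp add: d_zero d'_zero)
    then show "0 \<in> ?B p q" using zero_in by blast
    show "x + y \<in> ?B p q" if xy: "x \<in> ?B p q" "y \<in> ?B p q" for x y
    proof -
      obtain u v u' v' where "u \<in> A (p - 1) q" "v \<in> A p (q - 1)" "x = d u + d' v"
        "u' \<in> A (p - 1) q" "v' \<in> A p (q - 1)" "y = d u' + d' v'" using xy by blast
      then have "x + y = d (u + u') + d' (v + v')" "u + u' \<in> A (p - 1) q" "v + v' \<in> A p (q - 1)"
        by (simp_all add: d_add d'_add add_in)
      then show ?thesis by blast
    qed
    show "scale a x \<in> ?B p q" if x: "x \<in> ?B p q" for a x
    proof -
      obtain u v where "u \<in> A (p - 1) q" "v \<in> A p (q - 1)" "x = d u + d' v" using x by blast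
      then have "scale a x = d (scale a u) + d' (scale a v)" "scale a u \<in> A (p - 1) q" "scale a v \<in> A p (q - 1)"
        by (simp_all add: d_scale d'_scale scale_right_distrib scale_in)
      then show ?thesis by blast
    qed
  qed
  have subZ: "subspace (?Z p q)" for p q
    by (rule subspaceI)
      (auto simp: A_closed d_zero d'_zero d_add[OF d'_in d'_in] d'_add d_scale[OF d'_in] d'_scale)
  have subK: "subspace {x \<in> ?Z p q. \<exists>y\<in>S. d x = d' y}"
    if S: "subspace S" "S \<subseteq> A (p + 1) (q - 1)" for S
  proof (rule subspaceI)
    show "0 \<in> {x \<in> ?Z p q. \<exists>y\<in>S. d x = d' y}"
      using subspace_0[OF S(1)] subspace_0[OF subZ] d_zero d'_zero by force
    show "x + y \<in> {x \<in> ?Z p q. \<exists>y\<in>S. d x = d' y}"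
      if x: "x \<in> {x \<in> ?Z p q. \<exists>y\<in>S. d x = d' y}" and y: "y \<in> {x \<in> ?Z p q. \<exists>y\<in>S. d x = d' y}" for x y
    proof -
      obtain u v where *: "u \<in> S" "d x = d' u" "v \<in> S" "d y = d' v" using x y by blast
      have "x + y \<in> ?Z p q" by (rule subspace_add[OF subZ]) (use x y in auto)
      moreover have "d (x + y) = d' (u + v)" using * x y S(2) by (subst d_add d'_add; auto)+
      ultimately show ?thesis using subspace_add[OF S(1) *(1,3)] by blast
    qed
    show "scale a x \<in> {x \<in> ?Z p q. \<exists>y\<in>S. d x = d' y}"
      if x: "x \<in> {x \<in> ?Z p q. \<exists>y\<in>S. d x = d' y}" for a x
    proof -
      obtain u where *: "u \<in> S" "d x = d' u" using x by blast
      have "scale a x \<in> ?Z p q" by (rule subspace_scale[OF subZ]) (use x in auto)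
      moreover have "d (scale a x) = d' (scale a u)" using * x S(2) by (subst d_scale d'_scale; auto)+
      ultimately show ?thesis using subspace_scale[OF S(1) *(1)] by blast
    qed
  qed
  have subK1: "subspace ?K" by (rule subK[OF subspace_A order_refl])
  have subK2: "subspace ?K'" by (rule subK[OF subspace_inter[OF subspace_A subB]]) auto
  have 1: "qdim (?Z p q) ?K \<le> h_d' (p + 1) q"
    unfolding h_d'_def
  proof (rule qdim_le_relation[where R = "\<lambda>x y. x \<in> ?Z p q \<and> y = d x" and \<tau> = id])
    show "\<exists>y\<in>{x \<in> A (p + 1) q. d' x = 0}. x \<in> ?Z p q \<and> y = d x" if "x \<in> ?Z p q" for x
      using that by (auto simp: d_in d'_d)
    show "x + x' \<in> ?Z p q \<and> y + y' = d (x + x')"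
      if "x \<in> ?Z p q \<and> y = d x" "x' \<in> ?Z p q \<and> y' = d x'" for x y x' y'
      using that subspace_add[OF subZ, of x p q x'] by (auto simp: d_add)
    show "scale (id a) x \<in> ?Z p q \<and> scale a y = d (scale (id a) x)"
      if "x \<in> ?Z p q \<and> y = d x" for a x y
      using that subspace_scale[OF subZ, of x p q a] by (auto simp: d_scale)
    show "x \<in> ?K" if "x \<in> ?Z p q \<and> y = d x" "y \<in> d' ` A (p + 1) (q - 1)" for x y
      using that by auto
  qed (use subspace_0[OF subZ] d_zero d'_zero zero_in in force)+
  have 2: "qdim ?K ?K' \<le> h_A (p + 1) (q - 1)"
    unfolding h_A_def
  proof (rule qdim_le_relation[where R = "\<lambda>x y. x \<in> ?Z p q \<and> y \<in> A (p + 1) (q - 1) \<and> d x = d' y" and \<tau> = id])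
    show "\<exists>y\<in>?Z (p + 1) (q - 1). x \<in> ?Z p q \<and> y \<in> A (p + 1) (q - 1) \<and> d x = d' y" if x: "x \<in> ?K" for x
    proof -
      obtain y where y: "y \<in> A (p + 1) (q - 1)" "d x = d' y" using x by blast
      then have "d (d' y) = 0" using x d_d by force
      then show ?thesis using x y by blast
    qed
    show "x + x' \<in> ?Z p q \<and> y + y' \<in> A (p + 1) (q - 1) \<and> d (x + x') = d' (y + y')"
      if "x \<in> ?Z p q \<and> y \<in> A (p + 1) (q - 1) \<and> d x = d' y"
         "x' \<in> ?Z p q \<and> y' \<in> A (p + 1) (q - 1) \<and> d x' = d' y'" for x y x' y'
      using that subspace_add[OF subZ, of x p q x'] by (auto simp: d_add d'_add add_in)
    show "scale (id a) x \<in> ?Z p q \<and> scale a y \<in> A (p + 1) (q - 1) \<and> d (scale (id a) x) = d' (scale a y)"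
      if "x \<in> ?Z p q \<and> y \<in> A (p + 1) (q - 1) \<and> d x = d' y" for a x y
      using that subspace_scale[OF subZ, of x p q a] by (auto simp: d_scale d'_scale scale_in)
    show "0 \<in> ?B (p + 1) (q - 1)" by (rule subspace_0[OF subB])
  qed (use subspace_0[OF subZ] d_zero d'_zero zero_in in force)+
  have 3: "qdim ?K' (?B p q) \<le> h_d p q"
    unfolding h_d_def
  proof (rule qdim_le_relation[where R = "\<lambda>x y. \<exists>u\<in>A p (q - 1). y = x + d' u" and \<tau> = id])
    show "\<exists>y\<in>{x \<in> A p q. d x = 0}. \<exists>u\<in>A p (q - 1). y = x + d' u" if x: "x \<in> ?K'" for x
    proof -
      obtain y where "y \<in> ?B (p + 1) (q - 1)" "d x = d' y" using x by blast
      then obtain u v where u: "u \<in> A p (q - 1)" and v: "v \<in> A (p + 1) (q - 1 - 1)" and "d x = d' (d u + d' v)"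
        by auto
      \<comment> \<open>The part \<open>d' v\<close> of the partner is killed by \<open>d'\<close>.
        Anticommutation then turns \<open>d' (d u)\<close> into \<open>- d (d' u)\<close>, which
        explains the correction of x by \<open>+ d' u\<close>.\<close>
      then have "d x = d' (d u)" using d'_add[OF d_in[OF u] d'_in'[OF v]] by (simp add: d'_d'[OF v])
      then have "d (x + d' u) = 0" using x d_add[OF _ d'_in'[OF u], of x] by (simp add: d'_d[OF u])
      moreover have "x + d' u \<in> A p q" using x u by (auto intro: add_in d'_in')
      ultimately show ?thesis using u by blast
    qed
    show "\<exists>u\<in>A p (q - 1). y + y' = x + x' + d' u"
      if xy: "\<exists>u\<in>A p (q - 1). y = x + d' u" "\<exists>u\<in>A p (q - 1). y' = x' + d' u" for x y x' y'
    proof -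
      obtain u u' where u: "u \<in> A p (q - 1)" "y = x + d' u" "u' \<in> A p (q - 1)" "y' = x' + d' u'"
        using xy by blast
      then show ?thesis by (intro bexI[of _ "u + u'"]) (auto simp: d'_add add_in)
    qed
    show "\<exists>u\<in>A p (q - 1). scale a y = scale (id a) x + d' u"
      if xy: "\<exists>u\<in>A p (q - 1). y = x + d' u" for a x y
    proof -
      obtain u where u: "u \<in> A p (q - 1)" "y = x + d' u"
        using xy by blast
      then show ?thesis by (intro bexI[of _ "scale a u"]) (auto simp: d'_scale scale_in scale_right_distrib)
    qed
    show "x \<in> ?B p q" if xy: "\<exists>u\<in>A p (q - 1). y = x + d' u" "y \<in> d ` A (p - 1) q" for x y
    proof -
      obtain u v where uv: "u \<in> A p (q - 1)" "y = x + d' u" "v \<in> A (p - 1) q" "y = d v" using xy by blast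
      then have "x = d v + d' (- u)" by (simp add: d'_uminus algebra_simps)
      then show ?thesis using uv uminus_in by blast
    qed
  qed (use subspace_0[OF subZ] d_zero d'_zero zero_in in force)+
  have "h_A p q \<le> qdim (?Z p q) ?K + qdim ?K (?B p q)"
    unfolding h_A_def by (rule qdim_trans_le[OF subK1 subspace_0[OF subB]])
  also have "\<dots> \<le> qdim (?Z p q) ?K + (qdim ?K ?K' + qdim ?K' (?B p q))"
    by (intro add_left_mono qdim_trans_le[OF subK2 subspace_0[OF subB]])
  also have "\<dots> \<le> h_d' (p + 1) q + (h_A (p + 1) (q - 1) + h_d p q)"
    by (intro add_mono 1 2 3)
  finally show ?thesis by (simp add: add.assoc)
qed

text \<open>Here the filtration consists of images under \<open>d'\<close>: a class that vanishes in
  the cohomology of \<open>d'\<close> is \<open>d' u\<close>, and \<open>d u\<close> measures what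
  remains. If \<open>d u\<close> is trivial too, u can be chosen \<open>d\<close>-closed and its own
  class is the last obstruction.\<close>

lemma BottChern_step: "h_BC p q \<le> h_d' p q + h_BC (p + 1) (q - 1) + h_d p (q - 1)"
proof -
  let ?Z = "\<lambda>p q. {x \<in> A p q. d x = 0 \<and> d' x = 0}"
  let ?B = "\<lambda>p q. (\<lambda>y. d (d' y)) ` A (p - 1) (q - 1)"
  let ?K = "d' ` {y \<in> A p (q - 1). d (d' y) = 0}"
  let ?K' = "d' ` {y \<in> A p (q - 1). d y = 0}"
  have subim: "subspace (d' ` S)" if S: "subspace S" "S \<subseteq> A p (q - 1)" for S
  proof (rule subspaceI)
    show "0 \<in> d' ` S" using subspace_0[OF S(1)] d'_zero by force
    show "x + y \<in> d' ` S" if xy: "x \<in> d' ` S" "y \<in> d' ` S" for x y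
    proof -
      obtain u v where "u \<in> S" "x = d' u" "v \<in> S" "y = d' v" using xy by blast
      moreover from this have "x + y = d' (u + v)" using S(2) by (subst d'_add; auto)
      ultimately show ?thesis using subspace_add[OF S(1)] by blast
    qed
    show "scale a x \<in> d' ` S" if x: "x \<in> d' ` S" for a x
    proof -
      obtain u where "u \<in> S" "x = d' u" using x by blast
      moreover from this have "scale a x = d' (scale a u)" using S(2) by (subst d'_scale; auto)
      ultimately show ?thesis using subspace_scale[OF S(1)] by blast
    qed
  qed
  have zeroB: "0 \<in> ?B p q" for p q
    using zero_in d_zero d'_zero by (metis (no_types, lifting) imageI)
  have subK1: "subspace ?K"
    by (rule subim, rule subspaceI)
      (auto simp: A_closed d_zero d'_zero d_add[OF d'_in' d'_in'] d'_add d_scale[OF d'_in'] d'_scale)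
  have subK2: "subspace ?K'"
    by (rule subim, rule subspaceI) (auto simp: A_closed d_zero d_add d_scale)
  have 1: "qdim (?Z p q) ?K \<le> h_d' p q"
    unfolding h_d'_def
  proof (rule qdim_le_relation[where R = "\<lambda>x y. x = y \<and> d x = 0 \<and> x \<in> A p q" and \<tau> = id])
    show "x \<in> ?K" if "x = y \<and> d x = 0 \<and> x \<in> A p q" "y \<in> d' ` A p (q - 1)" for x y
      using that by auto
  qed (use d_zero d'_zero zero_in in \<open>auto simp: d_add d_scale add_in scale_in image_iff intro!: bexI[of _ 0]\<close>)
  have 2: "qdim ?K ?K' \<le> h_BC (p + 1) (q - 1)"
    unfolding h_BC_def
  proof (rule qdim_le_relation[where R = "\<lambda>x y. \<exists>u\<in>A p (q - 1). x = d' u \<and> y = d u" and \<tau> = id])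
    show "\<exists>y\<in>?Z (p + 1) (q - 1). \<exists>u\<in>A p (q - 1). x = d' u \<and> y = d u" if x: "x \<in> ?K" for x
    proof -
      obtain u where u: "u \<in> A p (q - 1)" "x = d' u" "d (d' u) = 0" using x by blast
      then have "d u \<in> ?Z (p + 1) (q - 1)" by (auto simp: d_in d_d d'_d)
      then show ?thesis using u by blast
    qed
    show "\<exists>u\<in>A p (q - 1). x + x' = d' u \<and> y + y' = d u"
      if xy: "\<exists>u\<in>A p (q - 1). x = d' u \<and> y = d u" "\<exists>u\<in>A p (q - 1). x' = d' u \<and> y' = d u" for x y x' y'
    proof -
      obtain u u' where "u \<in> A p (q - 1)" "x = d' u" "y = d u" "u' \<in> A p (q - 1)" "x' = d' u'" "y' = d u'"
        using xy by blast
      then show ?thesis by (intro bexI[of _ "u + u'"]) (auto simp: d_add d'_add add_in)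
    qed
    show "\<exists>u\<in>A p (q - 1). scale (id a) x = d' u \<and> scale a y = d u"
      if xy: "\<exists>u\<in>A p (q - 1). x = d' u \<and> y = d u" for a x y
    proof -
      obtain u where "u \<in> A p (q - 1)" "x = d' u" "y = d u" using xy by blast
      then show ?thesis by (intro bexI[of _ "scale a u"]) (auto simp: d_scale d'_scale scale_in)
    qed
    show "x \<in> ?K'"
      if xy: "\<exists>u\<in>A p (q - 1). x = d' u \<and> y = d u" "y \<in> ?B (p + 1) (q - 1)" for x y
    proof -
      obtain u v where u: "u \<in> A p (q - 1)" "x = d' u" "y = d u" and v: "v \<in> A p (q - 1 - 1)" "y = d (d' v)"
        using xy by auto
      \<comment> \<open>Changing u by \<open>d' v\<close> leaves x unchanged and removes
        \<open>d u = d (d' v)\<close>.\<close>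
      have "x = d' (u - d' v)" "d (u - d' v) = 0" "u - d' v \<in> A p (q - 1)"
        using u v d'_in'[OF v(1)] by (simp_all add: d'_diff d_diff d'_d' diff_in)
      then show ?thesis by blast
    qed
    show "0 \<in> ?B (p + 1) (q - 1)" by (rule zeroB)
  qed (use d_zero d'_zero zero_in in auto)
  have 3: "qdim ?K' (?B p q) \<le> h_d p (q - 1)"
    unfolding h_d_def
  proof (rule qdim_le_relation[where R = "\<lambda>x u. u \<in> A p (q - 1) \<and> x = d' u" and \<tau> = id])
    show "x \<in> ?B p q" if xu: "u \<in> A p (q - 1) \<and> x = d' u" "u \<in> d ` A (p - 1) (q - 1)" for x u
    proof -
      obtain v where v: "v \<in> A (p - 1) (q - 1)" "u = d v" using xu(2) by blast
      then have "x = d (d' (- v))" using xu(1) d'_in[OF v(1)] by (simp add: d'_d d'_uminus d_uminus)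
      then show ?thesis using uminus_in[OF v(1)] by blast
    qed
  qed (use d_zero d'_zero zero_in in \<open>auto simp: d'_add d'_scale add_in scale_in image_iff intro!: bexI[of _ 0]\<close>)
  have "h_BC p q \<le> qdim (?Z p q) ?K + qdim ?K (?B p q)"
    unfolding h_BC_def by (rule qdim_trans_le[OF subK1 zeroB])
  also have "\<dots> \<le> qdim (?Z p q) ?K + (qdim ?K ?K' + qdim ?K' (?B p q))"
    by (intro add_left_mono qdim_trans_le[OF subK2 zeroB])
  also have "\<dots> \<le> h_d' p q + (h_BC (p + 1) (q - 1) + h_d p (q - 1))"
    by (intro add_mono 1 2 3)
  finally show ?thesis by (simp add: add.assoc)
qed

lemma h_A_eq_0: "A p q \<subseteq> {0} \<Longrightarrow> h_A p q = 0"
  unfolding h_A_def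
  by (rule qdim_zero) (use zero_in d_zero d'_zero in \<open>auto intro!: exI[of _ 0]\<close>)

lemma h_BC_eq_0: "A p q \<subseteq> {0} \<Longrightarrow> h_BC p q = 0"
  unfolding h_BC_def
  by (rule qdim_zero) (use zero_in d_zero d'_zero in \<open>auto simp: image_iff intro!: bexI[of _ 0]\<close>)

lemma h_d'_eq_0: "A p q \<subseteq> {0} \<Longrightarrow> h_d' p q = 0"
  unfolding h_d'_def
  by (rule qdim_zero) (use zero_in d'_zero in \<open>auto simp: image_iff intro!: bexI[of _ 0]\<close>)

text \<open>Each step moves down the antidiagonal. The \<open>h_d'\<close> terms lie in total degree
  p + q + 1, the \<open>h_d\<close> terms in total degree p + q.\<close>

lemma h_A_le_iterate:
  "h_A p q \<le> (\<Sum>i<m. h_d' (p + int i + 1) (q - int i)) + (\<Sum>i<m. h_d (p + int i) (q - int i))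
     + h_A (p + int m) (q - int m)"
proof (induction m)
  case (Suc m)
  have "h_A (p + int m) (q - int m) \<le> h_d' (p + int m + 1) (q - int m)
      + h_A (p + int (Suc m)) (q - int (Suc m)) + h_d (p + int m) (q - int m)"
    using Aeppli_step[of "p + int m" "q - int m"] by (simp add: algebra_simps)
  from Suc.IH add_left_mono[OF this] show ?case
    by (rule order_trans[OF _ order_trans]) (simp add: ac_simps)
qed simp

text \<open>Now the \<open>h_d'\<close> terms lie in total degree p + q and the \<open>h_d\<close>
  terms in total degree p + q - 1, so the extra degree is the lower neighbour.\<close>

lemma h_BC_le_iterate:
  "h_BC p q \<le> (\<Sum>i<m. h_d' (p + int i) (q - int i)) + (\<Sum>i<m. h_d (p + int i) (q - int i - 1))
     + h_BC (p + int m) (q - int m)"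
proof (induction m)
  case (Suc m)
  have "h_BC (p + int m) (q - int m) \<le> h_d' (p + int m) (q - int m)
      + h_BC (p + int (Suc m)) (q - int (Suc m)) + h_d (p + int m) (q - int m - 1)"
    using BottChern_step[of "p + int m" "q - int m"] by (simp add: algebra_simps)
  from Suc.IH add_left_mono[OF this] show ?case
    by (rule order_trans[OF _ order_trans]) (simp add: ac_simps)
qed simp

end

section \<open>Alternating functions of lists\<close>

definition omit :: "nat \<Rightarrow> 'v list \<Rightarrow> 'v list" where
  "omit j vs = take j vs @ drop (Suc j) vs"

lemma length_omit: "j < length vs \<Longrightarrow> length (omit j vs) = length vs - 1"
  by (auto simp: omit_def)

lemma set_omit: "set (omit j vs) \<subseteq> set vs"
  by (auto simp: omit_def dest: in_set_takeD in_set_dropD)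

lemma map_omit: "map h (omit j vs) = omit j (map h vs)"
  by (simp add: omit_def take_map drop_map)

lemma omit_append_Cons: "omit (length xs) (xs @ x # ys) = xs @ ys"
  by (simp add: omit_def)

lemma split_list_at_two:
  assumes "a < b" "b < length vs"
  obtains xs x ys y zs where "vs = xs @ x # ys @ y # zs" "length xs = a" "length ys = b - a - 1"
proof
  show "vs = take a vs @ vs ! a # take (b - a - 1) (drop (Suc a) vs) @ vs ! b # drop (Suc b) vs"
  proof -
    have "drop (Suc a) vs = take (b - a - 1) (drop (Suc a) vs) @ drop b vs"
      using append_take_drop_id[of "b - a - 1" "drop (Suc a) vs"] assms by simp
    moreover have "drop b vs = vs ! b # drop (Suc b) vs" using assms Cons_nth_drop_Suc by metis
    moreover have "vs = take a vs @ vs ! a # drop (Suc a) vs"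
      using assms id_take_nth_drop by (metis less_trans)
    ultimately show ?thesis by metis
  qed
qed (use assms in auto)

text \<open>Once the earlier entry is gone, the later one sits at b - 1; this shift is the source of
  the sign in all later cancellations.\<close>

lemma omit_two:
  fixes xs ys zs x y
  defines "vs \<equiv> xs @ x # ys @ y # zs" and "a \<equiv> length xs" and "b \<equiv> length xs + length ys + 1"
  shows "omit b vs = xs @ x # ys @ zs" "omit a vs = xs @ ys @ y # zs"
    "omit a (omit b vs) = xs @ ys @ zs" "omit (b - 1) (omit a vs) = xs @ ys @ zs"
    "vs ! a = x" "vs ! b = y" "omit b vs ! a = x" "omit a vs ! (b - 1) = y"
proof -
  show 1: "omit b vs = xs @ x # ys @ zs"
    using omit_append_Cons[of "xs @ x # ys" y zs] by (simp add: vs_def b_def)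
  show 2: "omit a vs = xs @ ys @ y # zs"
    using omit_append_Cons[of "xs"] by (simp add: vs_def a_def)
  show "omit a (omit b vs) = xs @ ys @ zs" unfolding 1
    using omit_append_Cons[of "xs"] by (simp add: a_def)
  show "omit (b - 1) (omit a vs) = xs @ ys @ zs" unfolding 2
    using omit_append_Cons[of "xs @ ys" y zs] by (simp add: b_def)
  show "vs ! a = x" "vs ! b = y" "omit b vs ! a = x" "omit a vs ! (b - 1) = y"
    unfolding 1 2 by (simp_all add: vs_def a_def b_def nth_append)
qed

text \<open>Removing two entries of a list in either order gives the same list. Pairing the two orders, whose
  indices are \<open>(b, a)\<close> and \<open>(a, b - 1)\<close> for \<open>a < b\<close>, makes double sums over removals cancel.\<close>

lemma double_removal_sum_eq_0:
  fixes g :: "nat \<Rightarrow> nat \<Rightarrow> 'a::ab_group_add"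
  assumes "\<And>a b. a < b \<Longrightarrow> b < n \<Longrightarrow> g b a + g a (b - 1) = 0"
  shows "(\<Sum>j<n. \<Sum>l<n - 1. g j l) = 0"
proof -
  let ?P = "{..<n} \<times> {..<n - 1}"
  let ?L = "{(j, l). l < j \<and> j < n}" and ?U = "{(j, l). j \<le> l \<and> l < n - 1}"
  have "(\<Sum>j<n. \<Sum>l<n - 1. g j l) = (\<Sum>(j, l)\<in>?P. g j l)"
    by (simp add: sum.cartesian_product)
  also have "?P = ?L \<union> ?U" by auto
  also have "(\<Sum>(j, l)\<in>?L \<union> ?U. g j l) = (\<Sum>(j, l)\<in>?L. g j l) + (\<Sum>(j, l)\<in>?U. g j l)"
  proof (rule sum.union_disjoint)
    have "finite (?L \<union> ?U)" by (rule finite_subset[of _ ?P]) auto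
    then show "finite ?L" "finite ?U" by auto
  qed auto
  also have "(\<Sum>(j, l)\<in>?U. g j l) = (\<Sum>(b, a)\<in>?L. g a (b - 1))"
    by (rule sum.reindex_bij_witness[of _ "\<lambda>(b, a). (a, b - 1)" "\<lambda>(j, l). (Suc l, j)"]) auto
  also have "(\<Sum>(j, l)\<in>?L. g j l) + \<dots> = (\<Sum>(b, a)\<in>?L. g b a + g a (b - 1))"
    by (simp add: sum.distrib case_prod_unfold)
  also have "\<dots> = 0" by (rule sum.neutral) (use assms[unfolded One_nat_def] in auto)
  finally show ?thesis .
qed

definition alternating :: "('v list \<Rightarrow> complex) \<Rightarrow> bool" where
  "alternating f \<longleftrightarrow> (\<forall>xs x y ys. f (xs @ x # y # ys) = - f (xs @ y # x # ys))"

lemma alternating_move: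
  assumes "alternating f"
  shows "f (xs @ x # ys @ zs) = (-1) ^ length ys * f (xs @ ys @ x # zs)"
proof (induction ys arbitrary: xs)
  case (Cons y ys)
  have "f (xs @ x # y # ys @ zs) = - f ((xs @ [y]) @ x # ys @ zs)"
    using assms[unfolded alternating_def, rule_format, of xs x y "ys @ zs"] by simp
  also have "\<dots> = - ((-1) ^ length ys * f ((xs @ [y]) @ ys @ x # zs))"
    by (subst Cons.IH) simp
  finally show ?case by simp
qed simp

lemma alternating_swap_blocks:
  assumes "alternating f"
  shows "f (us @ xs @ ys) = (-1) ^ (length xs * length ys) * f (us @ ys @ xs)"
proof (induction xs arbitrary: us)
  case (Cons x xs)
  have "f (us @ x # xs @ ys) = (-1) ^ (length xs * length ys) * f (us @ x # ys @ xs)"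
    using Cons.IH[of "us @ [x]"] by simp
  also have "f (us @ x # ys @ xs) = (-1) ^ length ys * f (us @ ys @ x # xs)"
    by (rule alternating_move[OF assms])
  finally show ?case by (simp add: power_add algebra_simps)
qed simp

definition multilinear :: "('v::real_vector list \<Rightarrow> complex) \<Rightarrow> bool" where
  "multilinear f \<longleftrightarrow> (\<forall>xs ys. linear (\<lambda>x. f (xs @ x # ys)))"

text \<open>Models the second-order part of a pullback, with \<open>L\<close> the differential and
  \<open>B\<close> the Hessian of the coordinate change. For two chosen entries x and y,
  \<open>B x y\<close> arises once in the place of x and once in the place of y. Moving it across
  the entries in between produces exactly the opposite of the difference in removal signs.\<close>

lemma symmetric_insertion_sum_eq_0:
  assumes f: "alternating f"
    and sym: "\<And>v w. v \<in> set vs \<Longrightarrow> w \<in> set vs \<Longrightarrow> B v w = B w v"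
  shows "(\<Sum>j<length vs. (-1) ^ j * (\<Sum>l<length vs - 1. f ((map L (omit j vs))[l := B (vs ! j) (omit j vs ! l)]))) = 0"
  unfolding sum_distrib_left
proof (rule double_removal_sum_eq_0)
  fix a b assume ab: "a < b" "b < length vs"
  obtain xs x ys y zs where vs: "vs = xs @ x # ys @ y # zs" and a: "length xs = a" and b: "length ys = b - a - 1"
    using split_list_at_two[OF ab] .
  have b': "length xs + length ys + 1 = b" using a b ab by simp
  note o = omit_two[where xs = xs and x = x and ys = ys and y = y and zs = zs, folded vs, unfolded b', unfolded a]
  have "B x y = B y x" by (rule sym) (auto simp: vs)
  moreover have "(map L xs @ map L ys @ L y # map L zs)[b - 1 := s] = map L xs @ map L ys @ s # map L zs" for s
    using b'[symmetric] by (auto simp: list_update_append)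
  moreover have "(map L xs @ L x # map L ys @ map L zs)[a := s] = map L xs @ s # map L ys @ map L zs" for s
    using a by (simp add: list_update_append)
  moreover have "b = a + length ys + 1" using b ab by simp
  moreover have "(xs @ x # ys @ zs) ! a = x" "(xs @ ys @ y # zs) ! (b - 1) = y"
    using o(7,8) unfolding o(1,2) .
  ultimately show "(- 1) ^ b * f ((map L (omit b vs))[a := B (vs ! b) (omit b vs ! a)]) +
       (- 1) ^ a * f ((map L (omit a vs))[b - 1 := B (vs ! a) (omit a vs ! (b - 1))]) = 0"
    unfolding o(1,2,5,6)
    using alternating_move[OF f, of "map L xs" "B x y" "map L ys" "map L zs"]
    by (simp add: power_add)
qed

section \<open>Smooth functions on relatively open sets\<close>

lemma Ck_on_cong:
  "(\<And>x. x \<in> S \<Longrightarrow> f x = g x) \<Longrightarrow> Ck_on k S f \<longleftrightarrow> Ck_on k S g"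
proof (induction k)
  case 0 then show ?case by (simp cong: continuous_on_cong)
next
  case (Suc k)
  have "(f has_derivative f') (at x within S) \<longleftrightarrow> (g has_derivative f') (at x within S)" if "x \<in> S" for f' x
    using Suc.prems that by (metis has_derivative_transform)
  then show ?case by (simp cong: ball_cong)
qed

lemma Ck_on_zero: "Ck_on k S (\<lambda>x. 0)"
  by (induction k) (auto intro!: exI[of _ "\<lambda>x v. 0"])

lemma Ck_on_add: "Ck_on k S f \<Longrightarrow> Ck_on k S g \<Longrightarrow> Ck_on k S (\<lambda>x. f x + g x)"
proof (induction k arbitrary: f g)
  case 0 then show ?case by (simp add: continuous_on_add)
next
  case (Suc k)
  from Suc.prems obtain f' g' where
    "\<forall>x\<in>S. (f has_derivative f' x) (at x within S)" "\<forall>v. Ck_on k S (\<lambda>x. f' x v)"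
    "\<forall>x\<in>S. (g has_derivative g' x) (at x within S)" "\<forall>v. Ck_on k S (\<lambda>x. g' x v)" by auto
  then have "\<forall>x\<in>S. ((\<lambda>x. f x + g x) has_derivative (\<lambda>v. f' x v + g' x v)) (at x within S)"
    "\<forall>v. Ck_on k S (\<lambda>x. f' x v + g' x v)"
    by (auto intro: has_derivative_add Suc.IH)
  then show ?case by (auto intro!: exI[of _ "\<lambda>x v. f' x v + g' x v"])
qed

lemma Ck_on_bounded_linear:
  assumes h: "bounded_linear h"
  shows "Ck_on k S f \<Longrightarrow> Ck_on k S (\<lambda>x. h (f x))"
proof (induction k arbitrary: f)
  case 0 then show ?case using h by (simp add: bounded_linear.continuous_on)
next
  case (Suc k)
  from Suc.prems obtain f' where
    "\<forall>x\<in>S. (f has_derivative f' x) (at x within S)" "\<forall>v. Ck_on k S (\<lambda>x. f' x v)" by auto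
  then have "\<forall>x\<in>S. ((\<lambda>x. h (f x)) has_derivative (\<lambda>v. h (f' x v))) (at x within S)"
    "\<forall>v. Ck_on k S (\<lambda>x. h (f' x v))"
    by (auto intro: Suc.IH bounded_linear.has_derivative[OF h])
  then show ?case by (auto intro!: exI[of _ "\<lambda>x v. h (f' x v)"])
qed

lemma smooth_on_zero: "smooth_on S (\<lambda>x. 0)"
  by (simp add: smooth_on_def Ck_on_zero)

lemma smooth_on_add: "smooth_on S f \<Longrightarrow> smooth_on S g \<Longrightarrow> smooth_on S (\<lambda>x. f x + g x)"
  by (simp add: smooth_on_def Ck_on_add)

lemma smooth_on_bounded_linear: "bounded_linear h \<Longrightarrow> smooth_on S f \<Longrightarrow> smooth_on S (\<lambda>x. h (f x))"
  by (simp add: smooth_on_def Ck_on_bounded_linear)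

lemma smooth_on_mult_left:
  fixes f :: "'a::real_normed_vector \<Rightarrow> 'b::real_normed_algebra"
  shows "smooth_on S f \<Longrightarrow> smooth_on S (\<lambda>x. c * f x)"
  by (rule smooth_on_bounded_linear[OF bounded_linear_mult_right])

lemma smooth_on_sum: "(\<And>i. i \<in> K \<Longrightarrow> smooth_on S (f i)) \<Longrightarrow> smooth_on S (\<lambda>x. \<Sum>i\<in>K. f i x)"
  by (induction K rule: infinite_finite_induct) (auto intro: smooth_on_zero smooth_on_add)

lemma smooth_on_cong: "(\<And>x. x \<in> S \<Longrightarrow> f x = g x) \<Longrightarrow> smooth_on S f \<longleftrightarrow> smooth_on S g"
  unfolding smooth_on_def using Ck_on_cong by blast

lemma smooth_on_derivative_exists:
  assumes "smooth_on S f"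
  obtains f' where "\<And>x. x \<in> S \<Longrightarrow> (f has_derivative f' x) (at x within S)"
proof -
  have "Ck_on (Suc 0) S f" using assms by (simp only: smooth_on_def)
  then show thesis using that by auto
qed

text \<open>By the mean value theorem, both mixed partial derivatives are limits of the same second difference
  quotient.\<close>

lemma second_difference_mvt:
  fixes \<phi> :: "real \<Rightarrow> real \<Rightarrow> real"
  assumes s: "\<And>s t. \<bar>s\<bar> < e \<Longrightarrow> \<bar>t\<bar> < e \<Longrightarrow> ((\<lambda>s. \<phi> s t) has_real_derivative \<phi>s s t) (at s)"
    and st: "\<And>s t. \<bar>s\<bar> < e \<Longrightarrow> \<bar>t\<bar> < e \<Longrightarrow> ((\<lambda>t. \<phi>s s t) has_real_derivative \<phi>st s t) (at t)"
    and h: "0 < h" "h < e"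
  shows "\<exists>a b. 0 < a \<and> a < h \<and> 0 < b \<and> b < h \<and> \<phi> h h - \<phi> 0 h - (\<phi> h 0 - \<phi> 0 0) = h * (h * \<phi>st a b)"
proof -
  have "\<exists>a. 0 < a \<and> a < h \<and> (\<lambda>s. \<phi> s h - \<phi> s 0) h - (\<lambda>s. \<phi> s h - \<phi> s 0) 0 = (h - 0) * (\<phi>s a h - \<phi>s a 0)"
    by (rule MVT2[OF h(1)]) (use h in \<open>auto intro!: DERIV_diff s\<close>)
  then obtain a where a: "0 < a" "a < h" "\<phi> h h - \<phi> h 0 - (\<phi> 0 h - \<phi> 0 0) = h * (\<phi>s a h - \<phi>s a 0)" by auto
  have "\<exists>b. 0 < b \<and> b < h \<and> \<phi>s a h - \<phi>s a 0 = (h - 0) * \<phi>st a b"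
    by (rule MVT2[OF h(1)]) (use h a in \<open>auto intro!: st\<close>)
  then obtain b where b: "0 < b" "b < h" "\<phi>s a h - \<phi>s a 0 = h * \<phi>st a b" by auto
  then show ?thesis using a b by (intro exI[of _ a] exI[of _ b]) (auto simp: algebra_simps)
qed

lemma mixed_partials_eq_real:
  fixes \<phi> :: "real \<Rightarrow> real \<Rightarrow> real"
  assumes e: "e > 0"
    and s: "\<And>s t. \<bar>s\<bar> < e \<Longrightarrow> \<bar>t\<bar> < e \<Longrightarrow> ((\<lambda>s. \<phi> s t) has_real_derivative \<phi>s s t) (at s)"
    and t: "\<And>s t. \<bar>s\<bar> < e \<Longrightarrow> \<bar>t\<bar> < e \<Longrightarrow> ((\<lambda>t. \<phi> s t) has_real_derivative \<phi>t s t) (at t)"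
    and st: "\<And>s t. \<bar>s\<bar> < e \<Longrightarrow> \<bar>t\<bar> < e \<Longrightarrow> ((\<lambda>t. \<phi>s s t) has_real_derivative \<phi>st s t) (at t)"
    and ts: "\<And>s t. \<bar>s\<bar> < e \<Longrightarrow> \<bar>t\<bar> < e \<Longrightarrow> ((\<lambda>s. \<phi>t s t) has_real_derivative \<phi>ts s t) (at s)"
    and cst: "\<And>x y. x \<longlonglongrightarrow> 0 \<Longrightarrow> y \<longlonglongrightarrow> 0 \<Longrightarrow> (\<lambda>n::nat. \<phi>st (x n) (y n)) \<longlonglongrightarrow> \<phi>st 0 0"
    and cts: "\<And>x y. x \<longlonglongrightarrow> 0 \<Longrightarrow> y \<longlonglongrightarrow> 0 \<Longrightarrow> (\<lambda>n::nat. \<phi>ts (x n) (y n)) \<longlonglongrightarrow> \<phi>ts 0 0"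
  shows "\<phi>st 0 0 = \<phi>ts 0 0"
proof -
  \<comment> \<open>The shift by 2 makes h n strictly smaller than e already for n = 0.\<close>
  define h where "h n = e / real (n + 2)" for n
  have h: "0 < h n" "h n < e" for n
  proof -
    show "0 < h n" using e by (simp add: h_def)
    have "e * 1 < e * real (n + 2)" using e by (intro mult_strict_left_mono) auto
    then show "h n < e" by (simp add: h_def divide_less_eq)
  qed
  have h0: "h \<longlonglongrightarrow> 0" unfolding h_def
    using LIMSEQ_ignore_initial_segment[OF lim_const_over_n[of e], of 2] by simp
  have "\<exists>a b a' b'. 0 < a \<and> a < h n \<and> 0 < b \<and> b < h n \<and> 0 < a' \<and> a' < h n \<and> 0 < b' \<and> b' < h n
      \<and> \<phi>st a b = \<phi>ts a' b'" for n
  proof -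
    obtain a b where ab: "0 < a" "a < h n" "0 < b" "b < h n"
      "\<phi> (h n) (h n) - \<phi> 0 (h n) - (\<phi> (h n) 0 - \<phi> 0 0) = h n * (h n * \<phi>st a b)"
      using second_difference_mvt[OF s st h(1) h(2)] by blast
    obtain b' a' where ab': "0 < a'" "a' < h n" "0 < b'" "b' < h n"
      "\<phi> (h n) (h n) - \<phi> (h n) 0 - (\<phi> 0 (h n) - \<phi> 0 0) = h n * (h n * \<phi>ts a' b')"
      using second_difference_mvt[of e "\<lambda>t s. \<phi> s t" "\<lambda>t s. \<phi>t s t" "\<lambda>t s. \<phi>ts s t", OF t ts h(1) h(2)] by blast
    have "h n * (h n * \<phi>st a b) = h n * (h n * \<phi>ts a' b')"
      using ab(5) ab'(5) by (simp add: algebra_simps)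
    then have "\<phi>st a b = \<phi>ts a' b'" using h(1)[of n] by simp
    with ab(1-4) ab'(1-4) show ?thesis by blast
  qed
  then obtain a b a' b' where *: "\<And>n::nat. 0 < a n \<and> a n < h n \<and> 0 < b n \<and> b n < h n \<and> 0 < a' n \<and> a' n < h n
      \<and> 0 < b' n \<and> b' n < h n \<and> \<phi>st (a n) (b n) = \<phi>ts (a' n) (b' n)"
    by metis
  have lim: "x \<longlonglongrightarrow> 0" if "\<And>n. 0 < x n \<and> x n < h n" for x
    by (rule tendsto_sandwich[OF _ _ tendsto_const h0]) (use that in \<open>auto intro!: always_eventually less_imp_le\<close>)
  \<comment> \<open>The mean value points are known only to lie between 0 and h n, which is why
    continuity is assumed along arbitrary null sequences.\<close>
  have "(\<lambda>n. \<phi>st (a n) (b n)) \<longlonglongrightarrow> \<phi>st 0 0" using * by (intro cst lim) auto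
  moreover have "(\<lambda>n. \<phi>ts (a' n) (b' n)) \<longlonglongrightarrow> \<phi>ts 0 0" using * by (intro cts lim) auto
  moreover have "(\<lambda>n. \<phi>st (a n) (b n)) = (\<lambda>n. \<phi>ts (a' n) (b' n))" using * by auto
  ultimately show ?thesis by (simp add: LIMSEQ_unique)
qed

section \<open>Directional derivatives on relatively open sets\<close>

locale open_in_subspace =
  fixes V S :: "'a::real_normed_vector set"
  assumes subspace_V: "subspace V" and open_S: "openin (top_of_set V) S"
begin

lemma in_V: "z \<in> S \<Longrightarrow> z \<in> V"
  using open_S openin_imp_subset by blast

lemma near:
  assumes "z \<in> S"
  obtains e where "e > 0" "\<And>y. y \<in> V \<Longrightarrow> dist y z < e \<Longrightarrow> y \<in> S"
  using open_S assms by (auto simp: openin_euclidean_subtopology_iff)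

lemma plane_near:
  assumes z: "z \<in> S" and u: "u \<in> V" and v: "v \<in> V"
  obtains e where "e > 0" "\<And>s t::real. \<bar>s\<bar> < e \<Longrightarrow> \<bar>t\<bar> < e \<Longrightarrow> z + s *\<^sub>R u + t *\<^sub>R v \<in> S"
proof -
  obtain d where d: "d > 0" "\<And>y. y \<in> V \<Longrightarrow> dist y z < d \<Longrightarrow> y \<in> S" using near[OF z] by blast
  \<comment> \<open>The summand 1 keeps the denominator positive when u and v are both zero.\<close>
  define e where "e = d / (norm u + norm v + 1)"
  have pos: "norm u + norm v + 1 > 0" by (smt (verit) norm_ge_zero)
  have "e > 0" using d(1) pos by (simp add: e_def)
  moreover have "z + s *\<^sub>R u + t *\<^sub>R v \<in> S" if st: "\<bar>s\<bar> < e" "\<bar>t\<bar> < e" for s t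
  proof (rule d(2))
    show "z + s *\<^sub>R u + t *\<^sub>R v \<in> V" using subspace_V in_V[OF z] u v
      by (intro subspace_add subspace_scale) auto
    have "dist (z + s *\<^sub>R u + t *\<^sub>R v) z = norm (s *\<^sub>R u + t *\<^sub>R v)" by (simp add: dist_norm add.assoc)
    also have "\<dots> \<le> \<bar>s\<bar> * norm u + \<bar>t\<bar> * norm v" by (rule norm_triangle_le) simp
    also have "\<dots> \<le> e * norm u + e * norm v" using st by (intro add_mono mult_right_mono) auto
    also have "\<dots> < e * (norm u + norm v + 1)" using \<open>e > 0\<close> by (simp add: algebra_simps)
    also have "\<dots> = d" using pos by (simp add: e_def)
    finally show "dist (z + s *\<^sub>R u + t *\<^sub>R v) z < d" .
  qed
  ultimately show thesis using that by blast
qed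

lemma has_vector_derivative_curve:
  assumes f: "(f has_derivative f') (at (\<gamma> 0) within S)" and \<gamma>: "(\<gamma> has_vector_derivative v) (at 0)"
    and ev: "\<forall>\<^sub>F t in nhds 0. \<gamma> t \<in> S"
  shows "((\<lambda>t. f (\<gamma> t)) has_vector_derivative f' v) (at (0::real))"
proof -
  \<comment> \<open>On an open set of times that is mapped into \<open>S\<close>, the chain rule
    within sets applies. Openness then turns the derivative within \<open>T\<close> into an ordinary
    one.\<close>
  obtain T where T: "open T" "0 \<in> T" "\<gamma> ` T \<subseteq> S" using ev by (auto simp: eventually_nhds)
  have "(\<gamma> has_derivative (\<lambda>t. t *\<^sub>R v)) (at 0 within T)"
    using \<gamma> by (simp add: has_vector_derivative_def has_derivative_at_withinI)
  from diff_chain_within[OF this has_derivative_subset[OF f T(3)]]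
  have "((\<lambda>t. f (\<gamma> t)) has_derivative (\<lambda>t. f' (t *\<^sub>R v))) (at 0 within T)" by (simp add: o_def)
  then have "((\<lambda>t. f (\<gamma> t)) has_derivative (\<lambda>t. f' (t *\<^sub>R v))) (at 0)"
    using at_within_open[OF T(2,1)] by (simp only:)
  moreover have "f' (t *\<^sub>R v) = t *\<^sub>R f' v" for t using has_derivative_linear[OF f] by (rule linear_scale)
  ultimately show ?thesis by (simp add: has_vector_derivative_def)
qed

lemma eventually_line_in:
  assumes "z \<in> S" "v \<in> V" shows "\<forall>\<^sub>F t in nhds (0::real). z + t *\<^sub>R v \<in> S"
proof -
  obtain e where e: "e > 0" "\<And>s t::real. \<bar>s\<bar> < e \<Longrightarrow> \<bar>t\<bar> < e \<Longrightarrow> z + s *\<^sub>R v + t *\<^sub>R v \<in> S"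
    using plane_near[OF assms assms(2)] by blast
  then show ?thesis using e(2)[of 0] by (auto simp: eventually_nhds_metric dist_norm)
qed

lemma has_vector_derivative_line:
  assumes f: "(f has_derivative f') (at z within S)" and z: "z \<in> S" and v: "v \<in> V"
  shows "((\<lambda>t. f (z + t *\<^sub>R v)) has_vector_derivative f' v) (at 0)"
proof (rule has_vector_derivative_curve)
  show "(f has_derivative f') (at (z + 0 *\<^sub>R v) within S)" using f by simp
  show "((\<lambda>t. z + t *\<^sub>R v) has_vector_derivative v) (at 0)" by (auto intro!: derivative_eq_intros)
qed (rule eventually_line_in[OF z v])

lemma dir_deriv_eq:
  "(f has_derivative f') (at z within S) \<Longrightarrow> z \<in> S \<Longrightarrow> v \<in> V \<Longrightarrow> dir_deriv f z v = f' v"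
  unfolding dir_deriv_def by (rule vector_derivative_at) (rule has_vector_derivative_line)

text \<open>The derivative provided by \<open>Ck_on\<close> is arbitrary off \<open>V\<close>, but
  in directions of \<open>V\<close> it must agree with \<open>dir_deriv\<close>. Passing to this
  canonical derivative allows iteration.\<close>

lemma Ck_on_dir_deriv:
  assumes "Ck_on (Suc k) S f" "v \<in> V" shows "Ck_on k S (\<lambda>z. dir_deriv f z v)"
proof -
  obtain f' where f': "\<forall>x\<in>S. (f has_derivative f' x) (at x within S)" "Ck_on k S (\<lambda>x. f' x v)"
    using assms(1) by auto
  have "Ck_on k S (\<lambda>x. f' x v) \<longleftrightarrow> Ck_on k S (\<lambda>z. dir_deriv f z v)"
    by (rule Ck_on_cong) (use f'(1) dir_deriv_eq assms(2) in force)
  with f'(2) show ?thesis by blast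
qed

lemma smooth_on_dir_deriv: "smooth_on S f \<Longrightarrow> v \<in> V \<Longrightarrow> smooth_on S (\<lambda>z. dir_deriv f z v)"
  unfolding smooth_on_def using Ck_on_dir_deriv by blast

lemma smooth_on_has_vector_derivative:
  assumes "smooth_on S f" "z \<in> S" "v \<in> V"
  shows "((\<lambda>t. f (z + t *\<^sub>R v)) has_vector_derivative dir_deriv f z v) (at 0)"
proof -
  obtain f' where "\<And>x. x \<in> S \<Longrightarrow> (f has_derivative f' x) (at x within S)"
    using smooth_on_derivative_exists[OF assms(1)] by blast
  then show ?thesis using has_vector_derivative_line dir_deriv_eq assms(2,3) by metis
qed

lemma smooth_on_has_vector_derivative_at:
  assumes "smooth_on S f" "z + s *\<^sub>R v \<in> S" "v \<in> V"
  shows "((\<lambda>t. f (z + t *\<^sub>R v)) has_vector_derivative dir_deriv f (z + s *\<^sub>R v) v) (at s)"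
proof -
  have "((\<lambda>t. f ((z + s *\<^sub>R v) + t *\<^sub>R v)) has_vector_derivative dir_deriv f (z + s *\<^sub>R v) v) (at (-s + s))"
    using smooth_on_has_vector_derivative[OF assms] by simp
  moreover have "((\<lambda>t. t - s) has_vector_derivative 1) (at s)" by (auto intro!: derivative_eq_intros)
  ultimately show ?thesis
    using vector_diff_chain_at[of "\<lambda>t. t - s" 1 s "\<lambda>t. f ((z + s *\<^sub>R v) + t *\<^sub>R v)"]
    by (simp add: o_def algebra_simps)
qed

lemma dir_deriv_commute:
  fixes f :: "'a \<Rightarrow> 'b::real_inner"
  assumes f: "smooth_on S f" and z: "z \<in> S" and u: "u \<in> V" and v: "v \<in> V"
  shows "dir_deriv (\<lambda>w. dir_deriv f w u) z v = dir_deriv (\<lambda>w. dir_deriv f w v) z u"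
proof -
  \<comment> \<open>Testing against the difference x itself reduces the claim to real-valued
    functions: equality of the components along x says that x is orthogonal to itself.\<close>
  define x where "x = dir_deriv (\<lambda>w. dir_deriv f w u) z v - dir_deriv (\<lambda>w. dir_deriv f w v) z u"
  obtain e where e: "e > 0" "\<And>s t::real. \<bar>s\<bar> < e \<Longrightarrow> \<bar>t\<bar> < e \<Longrightarrow> z + s *\<^sub>R u + t *\<^sub>R v \<in> S"
    using plane_near[OF z u v] by blast
  let ?p = "\<lambda>s t. z + s *\<^sub>R u + t *\<^sub>R v"
  let ?fu = "\<lambda>w. dir_deriv f w u" and ?fv = "\<lambda>w. dir_deriv f w v"
  have fu: "smooth_on S ?fu" and fv: "smooth_on S ?fv" using f u v by (auto intro: smooth_on_dir_deriv)
  have du: "((\<lambda>s. g (?p s t) \<bullet> x) has_real_derivative dir_deriv g (?p s t) u \<bullet> x) (at s)"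
    if "smooth_on S g" "\<bar>s\<bar> < e" "\<bar>t\<bar> < e" for g :: "'a \<Rightarrow> 'b" and s t
  proof -
    have "((\<lambda>s. g ((z + t *\<^sub>R v) + s *\<^sub>R u)) has_vector_derivative dir_deriv g ((z + t *\<^sub>R v) + s *\<^sub>R u) u) (at s)"
      using smooth_on_has_vector_derivative_at[OF that(1) _ u, of "z + t *\<^sub>R v" s] e(2)[OF that(2,3)]
      by (simp add: ac_simps)
    from bounded_linear.has_vector_derivative[OF bounded_linear_inner_left this, of x] show ?thesis
      by (simp add: ac_simps has_real_derivative_iff_has_vector_derivative)
  qed
  have dv: "((\<lambda>t. g (?p s t) \<bullet> x) has_real_derivative dir_deriv g (?p s t) v \<bullet> x) (at t)"
    if "smooth_on S g" "\<bar>s\<bar> < e" "\<bar>t\<bar> < e" for g :: "'a \<Rightarrow> 'b" and s t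
  proof -
    have "((\<lambda>t. g ((z + s *\<^sub>R u) + t *\<^sub>R v)) has_vector_derivative dir_deriv g ((z + s *\<^sub>R u) + t *\<^sub>R v) v) (at t)"
      using smooth_on_has_vector_derivative_at[OF that(1) _ v] e(2)[OF that(2,3)] by simp
    from bounded_linear.has_vector_derivative[OF bounded_linear_inner_left this, of x] show ?thesis
      by (simp add: has_real_derivative_iff_has_vector_derivative)
  qed
  have lim: "(\<lambda>n::nat. g (?p (a n) (b n)) \<bullet> x) \<longlonglongrightarrow> g (?p 0 0) \<bullet> x"
    if g: "smooth_on S g" and ab: "a \<longlonglongrightarrow> 0" "b \<longlonglongrightarrow> 0" for g :: "'a \<Rightarrow> 'b" and a b
  proof (intro tendsto_intros)
    have "Ck_on 0 S g" using g by (simp only: smooth_on_def)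
    then have "continuous_on S g" by simp
    moreover have "(\<lambda>n. ?p (a n) (b n)) \<longlonglongrightarrow> ?p 0 0" using ab by (intro tendsto_intros)
    moreover have "\<forall>\<^sub>F n in sequentially. ?p (a n) (b n) \<in> S"
    proof -
      have "\<forall>\<^sub>F n in sequentially. \<bar>a n\<bar> < e \<and> \<bar>b n\<bar> < e"
        using ab[THEN tendstoD[OF _ e(1)]] by (simp add: eventually_conj_iff)
      then show ?thesis by eventually_elim (use e(2) in auto)
    qed
    ultimately show "(\<lambda>n. g (?p (a n) (b n))) \<longlonglongrightarrow> g (?p 0 0)"
      using z by (intro continuous_on_tendsto_compose[where f = g]) auto
  qed
  have "dir_deriv ?fu (?p 0 0) v \<bullet> x = dir_deriv ?fv (?p 0 0) u \<bullet> x"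
    by (rule mixed_partials_eq_real[where \<phi> = "\<lambda>s t. f (?p s t) \<bullet> x" and \<phi>s = "\<lambda>s t. ?fu (?p s t) \<bullet> x"
        and \<phi>t = "\<lambda>s t. ?fv (?p s t) \<bullet> x" and e = e
        and \<phi>st = "\<lambda>s t. dir_deriv ?fu (?p s t) v \<bullet> x" and \<phi>ts = "\<lambda>s t. dir_deriv ?fv (?p s t) u \<bullet> x"])
      (use e(1) in \<open>auto intro!: du dv lim f fu fv smooth_on_dir_deriv u v simp del: add_0_right scale_zero_left\<close>)
  then have "x \<bullet> x = 0" by (simp add: x_def inner_diff_left)
  then show ?thesis by (simp add: x_def)
qed

end

section \<open>Wedge products\<close>

lemma wedge_eq_det:
  assumes "length \<theta>s = n" "length vs = n"
  shows "wedge \<theta>s vs = Determinant.det (Matrix.mat n n (\<lambda>(i, j). (\<theta>s ! i) (vs ! j)))"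
proof -
  have "(\<Prod>i<n. (\<theta>s ! i) (vs ! \<pi> i)) = (\<Prod>i = 0..<n. Matrix.mat n n (\<lambda>(i, j). (\<theta>s ! i) (vs ! j)) $$ (i, \<pi> i))"
    if "\<pi> permutes {0..<n}" for \<pi>
    by (rule prod.cong) (use permutes_in_image[OF that] in \<open>auto simp: lessThan_atLeast0\<close>)
  then show ?thesis using assms
    by (subst det_def'[of _ n]) (auto simp: wedge_def lessThan_atLeast0 intro!: sum.cong)
qed

lemma wedge_length: "length vs \<noteq> length \<theta>s \<Longrightarrow> wedge \<theta>s vs = 0"
  by (simp add: wedge_def)

text \<open>Laplace expansion along the first row. It identifies the alternating sums over omitted
  arguments in \<open>del\<close> and \<open>delbar\<close> with wedge products from the
  left.\<close>

lemma wedge_Cons: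
  "wedge (\<theta> # \<theta>s) vs = (\<Sum>j<length vs. (-1) ^ j * (\<theta> (vs ! j) * wedge \<theta>s (omit j vs)))"
proof (cases "length vs = Suc (length \<theta>s)")
  case False
  then have "wedge \<theta>s (omit j vs) = 0" if "j < length vs" for j
    using that by (intro wedge_length) (auto simp: length_omit)
  then show ?thesis using False by (simp add: wedge_length)
next
  case True
  let ?n = "Suc (length \<theta>s)"
  let ?A = "Matrix.mat ?n ?n (\<lambda>(i, j). ((\<theta> # \<theta>s) ! i) (vs ! j))"
  have "wedge (\<theta> # \<theta>s) vs = Determinant.det ?A" using True by (intro wedge_eq_det) auto
  also have "\<dots> = (\<Sum>j<?n. ?A $$ (0, j) * cofactor ?A 0 j)"
    by (rule laplace_expansion_row) auto
  also have "\<dots> = (\<Sum>j<?n. (-1) ^ j * (\<theta> (vs ! j) * wedge \<theta>s (omit j vs)))"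
  proof (rule sum.cong[OF refl])
    fix j assume j: "j \<in> {..<?n}"
    have "mat_delete ?A 0 j = Matrix.mat (length \<theta>s) (length \<theta>s) (\<lambda>(i, k). (\<theta>s ! i) (omit j vs ! k))"
      using j True by (intro eq_matI) (auto simp: mat_delete_def omit_def nth_append min_def)
    then have "cofactor ?A 0 j = (-1) ^ j * wedge \<theta>s (omit j vs)"
      using j True by (simp add: cofactor_def wedge_eq_det[of \<theta>s "length \<theta>s"] length_omit)
    then show "?A $$ (0, j) * cofactor ?A 0 j = (-1) ^ j * (\<theta> (vs ! j) * wedge \<theta>s (omit j vs))"
      using j by simp
  qed
  finally show ?thesis using True by simp
qed

lemma wedge_swap:
  assumes n: "length \<theta>s = n" "length vs = n" "length \<theta>s' = n" "length vs' = n" and k: "Suc k < n"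
    and eq: "\<And>i j. i < n \<Longrightarrow> j < n \<Longrightarrow> (\<theta>s' ! i) (vs' ! j) = (\<theta>s ! Transposition.transpose k (Suc k) i) (vs ! j)"
  shows "wedge \<theta>s' vs' = - wedge \<theta>s vs"
proof -
  let ?p = "Transposition.transpose k (Suc k)"
  let ?A = "Matrix.mat n n (\<lambda>(i, j). (\<theta>s ! i) (vs ! j))"
  have p: "?p permutes {0..<n}" using k by (intro permutes_swap_id) auto
  have "wedge \<theta>s' vs' = Determinant.det (Matrix.mat n n (\<lambda>(i, j). (\<theta>s' ! i) (vs' ! j)))"
    using n by (intro wedge_eq_det)
  also have "Matrix.mat n n (\<lambda>(i, j). (\<theta>s' ! i) (vs' ! j)) = Matrix.mat n n (\<lambda>(i, j). ?A $$ (?p i, j))"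
    using permutes_in_image[OF p] by (intro eq_matI) (auto simp: eq)
  also have "Determinant.det \<dots> = signof ?p * Determinant.det ?A"
    by (rule det_permute_rows[OF _ p]) simp
  also have "\<dots> = - wedge \<theta>s vs" using n by (simp add: wedge_eq_det sign_swap_id)
  finally show ?thesis .
qed

lemma nth_swap_adjacent:
  "(xs @ y # x # ys) ! i = (xs @ x # y # ys) ! Transposition.transpose (length xs) (Suc (length xs)) i"
proof -
  consider "i < length xs" | "i = length xs" | "i = Suc (length xs)" | "i > Suc (length xs)" by linarith
  then show ?thesis by cases (auto simp: nth_append Transposition.transpose_def nth_Cons split: nat.splits)
qed

lemma alternating_wedge_covectors: "alternating (\<lambda>\<theta>s. wedge \<theta>s vs)"
  unfolding alternating_def
proof (intro allI)
  fix xs ys :: "('a \<Rightarrow> complex) list" and x y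
  show "wedge (xs @ x # y # ys) vs = - wedge (xs @ y # x # ys) vs"
  proof (cases "length vs = length xs + length ys + 2")
    case True
    then show ?thesis
      by (intro wedge_swap[where k = "length xs" and n = "length vs"])
        (auto simp: nth_swap_adjacent[of xs x y ys])
  qed (simp add: wedge_length)
qed

text \<open>A determinant equals that of its transpose: vectors become evaluation functionals on
  covectors. Hence alternation in the vectors follows from alternation in the covectors.\<close>

lemma wedge_transpose: "length vs = length \<theta>s \<Longrightarrow> wedge \<theta>s vs = wedge (map (\<lambda>v \<theta>. \<theta> v) vs) \<theta>s"
proof -
  assume n: "length vs = length \<theta>s"
  let ?n = "length \<theta>s"
  have "wedge (map (\<lambda>v \<theta>. \<theta> v) vs) \<theta>s = Determinant.det (Matrix.mat ?n ?n (\<lambda>(i, j). (\<theta>s ! j) (vs ! i)))"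
    by (subst wedge_eq_det[of _ ?n]) (auto simp: n intro!: arg_cong[of _ _ Determinant.det] eq_matI)
  also have "Matrix.mat ?n ?n (\<lambda>(i, j). (\<theta>s ! j) (vs ! i)) = transpose_mat (Matrix.mat ?n ?n (\<lambda>(i, j). (\<theta>s ! i) (vs ! j)))"
    by (intro eq_matI) auto
  also have "Determinant.det \<dots> = wedge \<theta>s vs"
    by (subst det_transpose[of _ ?n]) (auto simp: wedge_eq_det n)
  finally show ?thesis by simp
qed

lemma alternating_wedge: "alternating (wedge \<theta>s)"
  unfolding alternating_def
proof (intro allI)
  fix xs ys :: "'a list" and x y
  show "wedge \<theta>s (xs @ x # y # ys) = - wedge \<theta>s (xs @ y # x # ys)"
  proof (cases "length \<theta>s = length xs + length ys + 2")
    case True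
    then have "length (xs @ x # y # ys) = length \<theta>s" "length (xs @ y # x # ys) = length \<theta>s" by simp_all
    note this[THEN wedge_transpose]
    then show ?thesis
      using alternating_wedge_covectors[of \<theta>s, unfolded alternating_def, rule_format,
          of "map (\<lambda>v \<theta>. \<theta> v) xs" "\<lambda>\<theta>. \<theta> x" "\<lambda>\<theta>. \<theta> y" "map (\<lambda>v \<theta>. \<theta> v) ys"]
      by simp
  qed (simp add: wedge_length)
qed

lemma wedge_eq_0_if_not_distinct:
  assumes "\<not> distinct \<theta>s" shows "wedge \<theta>s vs = 0"
proof (cases "length vs = length \<theta>s")
  case True
  obtain i j where "i < length \<theta>s" "j < length \<theta>s" "i \<noteq> j" "\<theta>s ! i = \<theta>s ! j"
    using assms by (auto simp: distinct_conv_nth)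
  then show ?thesis
    by (subst wedge_eq_det[OF refl True])
      (rule det_identical_rows[of _ "length \<theta>s" i j], auto intro!: eq_vecI)
qed (simp add: wedge_length)

lemma multilinear_wedge:
  assumes lin: "\<And>\<theta>. \<theta> \<in> set \<theta>s \<Longrightarrow> linear \<theta>"
  shows "multilinear (wedge \<theta>s)"
  unfolding multilinear_def
proof (intro allI)
  fix xs ys :: "'a list"
  show "linear (\<lambda>x. wedge \<theta>s (xs @ x # ys))"
  proof (cases "length \<theta>s = length xs + length ys + 1")
    case False
    then have "(\<lambda>x. wedge \<theta>s (xs @ x # ys)) = (\<lambda>x. 0)" by (auto simp: wedge_length)
    then show ?thesis by (simp add: linear_zero)
  next
    case True
    let ?n = "length \<theta>s" and ?k = "length xs"
    have "linear (\<lambda>x. of_int (sign \<pi>) * (\<Prod>i<?n. (\<theta>s ! i) ((xs @ x # ys) ! \<pi> i)))"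
      if \<pi>: "\<pi> permutes {..<?n}" for \<pi>
    proof -
      \<comment> \<open>Each permutation feeds x to exactly one factor, the one with index m. In the
        other factors x can be replaced by the dummy 0.\<close>
      have "?k \<in> \<pi> ` {..<?n}" using permutes_image[OF \<pi>] True by auto
      then obtain m where m: "m < ?n" "\<pi> m = ?k" by auto
      have ne: "\<pi> i \<noteq> ?k" if "i \<noteq> m" for i
        using m(2) permutes_inj[OF \<pi>] that by (metis injD)
      have "(\<Prod>i<?n. (\<theta>s ! i) ((xs @ x # ys) ! \<pi> i)) =
          (\<theta>s ! m) x * (\<Prod>i\<in>{..<?n} - {m}. (\<theta>s ! i) ((xs @ 0 # ys) ! \<pi> i))" for x
      proof -
        have "(\<Prod>i<?n. (\<theta>s ! i) ((xs @ x # ys) ! \<pi> i)) =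
          (\<theta>s ! m) ((xs @ x # ys) ! \<pi> m) * (\<Prod>i\<in>{..<?n} - {m}. (\<theta>s ! i) ((xs @ x # ys) ! \<pi> i))"
          by (rule prod.remove) (use m in auto)
        also have "(\<Prod>i\<in>{..<?n} - {m}. (\<theta>s ! i) ((xs @ x # ys) ! \<pi> i)) = (\<Prod>i\<in>{..<?n} - {m}. (\<theta>s ! i) ((xs @ 0 # ys) ! \<pi> i))"
          by (rule prod.cong[OF refl]) (use ne in \<open>auto simp: nth_append nth_Cons split: nat.splits\<close>)
        finally show ?thesis by (simp add: m)
      qed
      moreover have "linear (\<theta>s ! m)" using lin m by auto
      ultimately show ?thesis
        by (auto intro!: linearI simp: linear_add linear_scale algebra_simps scaleR_conv_of_real)
    qed
    then have "linear (\<lambda>x. \<Sum>\<pi> | \<pi> permutes {..<?n}. of_int (sign \<pi>) * (\<Prod>i<?n. (\<theta>s ! i) ((xs @ x # ys) ! \<pi> i)))"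
      by (intro linear_compose_sum) auto
    with True show ?thesis by (simp add: wedge_def)
  qed
qed

lemma cnj_wedge: "cnj (wedge \<theta>s vs) = wedge (map (\<lambda>\<theta> v. cnj (\<theta> v)) \<theta>s) vs"
  by (auto simp: wedge_def intro!: sum.cong prod.cong)

section \<open>Finite-dimensional spans of functions\<close>

definition cspan :: "('x \<Rightarrow> complex) set \<Rightarrow> ('x \<Rightarrow> complex) set" where
  "cspan M = {\<alpha>. \<exists>a. \<alpha> = (\<lambda>x. \<Sum>\<beta>\<in>M. a \<beta> * \<beta> x)}"

lemma cspan_zero: "(\<lambda>x. 0) \<in> cspan M"
  unfolding cspan_def by (auto intro!: exI[of _ "\<lambda>_. 0"])

lemma cspan_add: "\<alpha> \<in> cspan M \<Longrightarrow> \<beta> \<in> cspan M \<Longrightarrow> (\<lambda>x. \<alpha> x + \<beta> x) \<in> cspan M"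
proof -
  assume "\<alpha> \<in> cspan M" "\<beta> \<in> cspan M"
  then obtain a b where "\<alpha> = (\<lambda>x. \<Sum>\<beta>\<in>M. a \<beta> * \<beta> x)" "\<beta> = (\<lambda>x. \<Sum>\<beta>\<in>M. b \<beta> * \<beta> x)"
    by (auto simp: cspan_def)
  then show ?thesis unfolding cspan_def
    by (auto intro!: exI[of _ "\<lambda>\<beta>. a \<beta> + b \<beta>"] simp: sum.distrib algebra_simps)
qed

lemma cspan_scale: "\<alpha> \<in> cspan M \<Longrightarrow> (\<lambda>x. c * \<alpha> x) \<in> cspan M"
proof -
  assume "\<alpha> \<in> cspan M"
  then obtain a where "\<alpha> = (\<lambda>x. \<Sum>\<beta>\<in>M. a \<beta> * \<beta> x)" by (auto simp: cspan_def)
  then show ?thesis unfolding cspan_def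
    by (auto intro!: exI[of _ "\<lambda>\<beta>. c * a \<beta>"] simp: sum_distrib_left mult.assoc)
qed

lemma cspan_sum: "(\<And>i. i \<in> K \<Longrightarrow> \<alpha> i \<in> cspan M) \<Longrightarrow> (\<lambda>x. \<Sum>i\<in>K. \<alpha> i x) \<in> cspan M"
  by (induction K rule: infinite_finite_induct) (auto intro: cspan_zero cspan_add)

lemma cspan_base: "finite M \<Longrightarrow> \<beta> \<in> M \<Longrightarrow> \<beta> \<in> cspan M"
  unfolding cspan_def
  by (auto intro!: exI[of _ "\<lambda>\<gamma>. if \<gamma> = \<beta> then 1 else 0"] simp: if_distrib[of "\<lambda>x. x * _"] sum.delta cong: if_cong)

text \<open>A basis dual to point evaluations. The generators may be dependent, so coefficients with
  respect to them are ambiguous; the values at the points \<open>x i\<close> determine an element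
  linearly and without choices.\<close>

lemma cspan_evaluation:
  assumes "finite M"
  shows "\<exists>N x b. (\<forall>i<N. b i \<in> cspan M) \<and> (\<forall>\<alpha>\<in>cspan M. \<alpha> = (\<lambda>y. \<Sum>i<(N::nat). \<alpha> (x i) * b i y))"
  using assms
proof (induction M rule: finite_induct)
  case empty
  show ?case by (rule exI[of _ 0]) (auto simp: cspan_def)
next
  case (insert \<beta> M)
  obtain N x b where b: "\<And>i. i < (N::nat) \<Longrightarrow> b i \<in> cspan M"
    and ev: "\<And>\<alpha>. \<alpha> \<in> cspan M \<Longrightarrow> \<alpha> = (\<lambda>y. \<Sum>i<N. \<alpha> (x i) * b i y)"
    using insert.IH by blast
  have dec: "\<exists>c. \<exists>\<gamma>\<in>cspan M. \<alpha> = (\<lambda>y. c * \<beta> y + \<gamma> y)" if "\<alpha> \<in> cspan (insert \<beta> M)" for \<alpha>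
    using that insert.hyps unfolding cspan_def by auto
  have sub: "\<gamma> \<in> cspan (insert \<beta> M)" if \<gamma>: "\<gamma> \<in> cspan M" for \<gamma>
  proof -
    obtain a where "\<gamma> = (\<lambda>y. \<Sum>\<delta>\<in>M. a \<delta> * \<delta> y)" using \<gamma> by (auto simp: cspan_def)
    then have "\<gamma> = (\<lambda>y. \<Sum>\<delta>\<in>insert \<beta> M. (if \<delta> = \<beta> then 0 else a \<delta>) * \<delta> y)"
      using insert.hyps by (auto intro!: sum.cong)
    then show ?thesis unfolding cspan_def by (intro CollectI exI)
  qed
  have \<beta>in: "\<beta> \<in> cspan (insert \<beta> M)" using insert.hyps by (intro cspan_base) auto
  \<comment> \<open>The error of reconstructing the new generator from the old points. If it
    vanishes, the old points still suffice; otherwise a point where it is nonzero is added.\<close>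
  define r where "r y = \<beta> y - (\<Sum>i<N. \<beta> (x i) * b i y)" for y
  have rin: "r \<in> cspan (insert \<beta> M)"
  proof -
    have "(\<lambda>y. \<beta> y + (-1) * (\<Sum>i<N. \<beta> (x i) * b i y)) \<in> cspan (insert \<beta> M)"
      using b sub by (intro cspan_add cspan_scale cspan_sum \<beta>in) auto
    then show ?thesis by (simp add: r_def[abs_def])
  qed
  have res: "\<alpha> y - (\<Sum>i<N. \<alpha> (x i) * b i y) = c * r y"
    if \<alpha>: "\<alpha> = (\<lambda>y. c * \<beta> y + \<gamma> y)" "\<gamma> \<in> cspan M" for \<alpha> c \<gamma> y
    using fun_cong[OF ev[OF that(2)], of y]
    by (simp add: \<alpha>(1) r_def algebra_simps sum.distrib sum_distrib_left)
  show ?case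
  proof (cases "r = (\<lambda>y. 0)")
    case True
    have "\<alpha> = (\<lambda>y. \<Sum>i<N. \<alpha> (x i) * b i y)" if \<alpha>: "\<alpha> \<in> cspan (insert \<beta> M)" for \<alpha>
    proof
      fix y
      obtain c \<gamma> where c: "\<alpha> = (\<lambda>y. c * \<beta> y + \<gamma> y)" "\<gamma> \<in> cspan M" using dec[OF \<alpha>] by blast
      show "\<alpha> y = (\<Sum>i<N. \<alpha> (x i) * b i y)" using res[OF c, of y] True by simp
    qed
    then show ?thesis using b sub by blast
  next
    case False
    then obtain x0 where x0: "r x0 \<noteq> 0" by auto
    define b0 where "b0 y = inverse (r x0) * r y" for y
    have b0: "b0 \<in> cspan (insert \<beta> M)" unfolding b0_def[abs_def] by (rule cspan_scale[OF rin])
    let ?x = "\<lambda>i. if i < N then x i else x0"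
    \<comment> \<open>The old elements are corrected to vanish at the new point \<open>x0\<close>,
      where \<open>b0\<close> has value 1.\<close>
    let ?b = "\<lambda>i y. if i < N then b i y - b i x0 * b0 y else b0 y"
    have "?b i \<in> cspan (insert \<beta> M)" if "i < Suc N" for i
    proof (cases "i < N")
      case True
      have "(\<lambda>y. b i y + (- b i x0) * b0 y) \<in> cspan (insert \<beta> M)"
        using True b sub by (intro cspan_add cspan_scale b0) auto
      then show ?thesis using True by simp
    qed (simp add: b0)
    moreover have "\<alpha> y = (\<Sum>i<Suc N. \<alpha> (?x i) * ?b i y)" if \<alpha>: "\<alpha> \<in> cspan (insert \<beta> M)" for \<alpha> y
    proof -
      obtain c \<gamma> where c: "\<alpha> = (\<lambda>y. c * \<beta> y + \<gamma> y)" "\<gamma> \<in> cspan M" using dec[OF \<alpha>] by blast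
      have "\<alpha> y = (\<Sum>i<N. \<alpha> (x i) * b i y) + c * r y" using res[OF c, of y] by (simp add: algebra_simps)
      also have "c * r y = (c * r x0) * b0 y" using x0 by (simp add: b0_def)
      also have "c * r x0 = \<alpha> x0 - (\<Sum>i<N. \<alpha> (x i) * b i x0)" using res[OF c, of x0] by simp
      also have "(\<Sum>i<N. \<alpha> (x i) * b i y) + (\<alpha> x0 - (\<Sum>i<N. \<alpha> (x i) * b i x0)) * b0 y
          = (\<Sum>i<Suc N. \<alpha> (?x i) * ?b i y)"
        by (simp add: algebra_simps sum_subtractf sum_distrib_left)
      finally show ?thesis .
    qed
    ultimately show ?thesis by (intro exI[of _ "Suc N"] exI[of _ ?x] exI[of _ ?b]) blast
  qed
qed

text \<open>The expansion by point values can be differentiated term by term, whereas coefficients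
  with respect to \<open>M\<close>, chosen separately for each t, need not depend differentiably on
  t.\<close>

lemma cspan_derivative:
  fixes f :: "real \<Rightarrow> 'x \<Rightarrow> complex"
  assumes M: "finite M" and f: "\<And>t. f t \<in> cspan M"
    and f': "\<And>y. ((\<lambda>t. f t y) has_vector_derivative f' y) (at 0)"
  shows "f' \<in> cspan M"
proof -
  obtain N x b where b: "\<And>i. i < (N::nat) \<Longrightarrow> b i \<in> cspan M"
    and ev: "\<And>\<alpha>. \<alpha> \<in> cspan M \<Longrightarrow> \<alpha> = (\<lambda>y. \<Sum>i<N. \<alpha> (x i) * b i y)"
    using cspan_evaluation[OF M] by blast
  define g where "g y = (\<Sum>i<N. f' (x i) * b i y)" for y
  have "f' y = g y" for y
    unfolding g_def
  proof (rule vector_derivative_unique_at)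
    show "((\<lambda>t. f t y) has_vector_derivative f' y) (at 0)" by (rule f')
    have "((\<lambda>t. \<Sum>i<N. f t (x i) * b i y) has_vector_derivative (\<Sum>i<N. f' (x i) * b i y)) (at 0)"
      by (intro has_vector_derivative_sum has_vector_derivative_mult_left f')
    moreover have "(\<lambda>t. \<Sum>i<N. f t (x i) * b i y) = (\<lambda>t. f t y)"
    proof
      fix t
      show "(\<Sum>i<N. f t (x i) * b i y) = f t y" using fun_cong[OF ev[OF f[of t]], of y] by (rule sym)
    qed
    ultimately show "((\<lambda>t. f t y) has_vector_derivative (\<Sum>i<N. f' (x i) * b i y)) (at 0)" by simp
  qed
  then have "f' = g" by (rule ext)
  moreover have "g \<in> cspan M" unfolding g_def[abs_def] by (intro cspan_sum cspan_scale b) auto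
  ultimately show ?thesis by simp
qed

section \<open>Wirtinger derivatives\<close>

lemma multilinear_expand:
  fixes f :: "'v::euclidean_space list \<Rightarrow> complex"
  assumes "multilinear f"
  shows "f (xs @ x # ys) = (\<Sum>b\<in>Basis. inner x b *\<^sub>R f (xs @ b # ys))"
proof -
  have lin: "linear (\<lambda>x. f (xs @ x # ys))" using assms by (simp add: multilinear_def)
  have "f (xs @ x # ys) = f (xs @ (\<Sum>b\<in>Basis. inner x b *\<^sub>R b) # ys)" by (simp add: euclidean_representation)
  also have "\<dots> = (\<Sum>b\<in>Basis. inner x b *\<^sub>R f (xs @ b # ys))"
    by (simp add: linear_sum[OF lin] linear_scale[OF lin])
  finally show ?thesis .
qed

text \<open>Product rule for a form evaluated on moving vectors. Differentiability is assumed for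
  fixed arguments only, so the moving ones are expanded one by one in a basis, leaving real
  coefficients that depend on t. The prefix \<open>us\<close> holds the arguments already
  frozen.\<close>

lemma has_vector_derivative_multilinear:
  fixes H :: "real \<Rightarrow> 'v::euclidean_space list \<Rightarrow> complex"
  assumes ml: "\<And>t. multilinear (H t)"
    and H': "\<And>us. ((\<lambda>t. H t us) has_vector_derivative H' us) (at 0)"
    and Ls: "\<And>L. L \<in> set Ls \<Longrightarrow> (L has_vector_derivative D L) (at 0)"
  shows "((\<lambda>t. H t (us @ map (\<lambda>L. L t) Ls)) has_vector_derivative
    H' (us @ map (\<lambda>L. L 0) Ls) + (\<Sum>l<length Ls. H 0 (us @ (map (\<lambda>L. L 0) Ls)[l := D (Ls ! l)]))) (at 0)"
  using Ls
proof (induction Ls arbitrary: us)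
  case Nil
  then show ?case using H' by simp
next
  case (Cons L Ls)
  let ?W = "map (\<lambda>L. L 0) Ls"
  let ?W' = "\<lambda>l. ?W[l := D (Ls ! l)]"
  let ?G = "\<lambda>b. H' (us @ b # ?W) + (\<Sum>l<length Ls. H 0 (us @ b # ?W' l))"
  \<comment> \<open>Nothing is assumed about the dependence of \<open>H'\<close> on its arguments;
    it inherits linearity from \<open>H t\<close> by uniqueness of derivatives.\<close>
  have H'_expand: "H' (us @ x # ws) = (\<Sum>b\<in>Basis. inner x b *\<^sub>R H' (us @ b # ws))" for x ws
  proof (rule vector_derivative_unique_at[OF H'])
    have "((\<lambda>t. \<Sum>b\<in>Basis. inner x b *\<^sub>R H t (us @ b # ws)) has_vector_derivative
        (\<Sum>b\<in>Basis. inner x b *\<^sub>R H' (us @ b # ws))) (at 0)"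
      by (intro has_vector_derivative_sum bounded_linear.has_vector_derivative[OF bounded_linear_scaleR_right] H')
    then show "((\<lambda>t. H t (us @ x # ws)) has_vector_derivative (\<Sum>b\<in>Basis. inner x b *\<^sub>R H' (us @ b # ws))) (at 0)"
      by (subst multilinear_expand[OF ml])
  qed
  have L: "((\<lambda>t. inner (L t) b) has_real_derivative inner (D L) b) (at 0)" for b
    using bounded_linear.has_vector_derivative[OF bounded_linear_inner_left Cons.prems[of L]]
    by (simp add: has_real_derivative_iff_has_vector_derivative)
  have IH: "((\<lambda>t. H t (us @ b # map (\<lambda>L. L t) Ls)) has_vector_derivative ?G b) (at 0)" for b
    using Cons.IH[of "us @ [b]"] Cons.prems by simp
  have "((\<lambda>t. \<Sum>b\<in>Basis. inner (L t) b *\<^sub>R H t (us @ b # map (\<lambda>L. L t) Ls)) has_vector_derivative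
      (\<Sum>b\<in>Basis. inner (L 0) b *\<^sub>R ?G b + inner (D L) b *\<^sub>R H 0 (us @ b # ?W))) (at 0)"
    by (intro has_vector_derivative_sum has_vector_derivative_scaleR[OF L IH])
  moreover have "(\<lambda>t. \<Sum>b\<in>Basis. inner (L t) b *\<^sub>R H t (us @ b # map (\<lambda>L. L t) Ls))
      = (\<lambda>t. H t (us @ map (\<lambda>L. L t) (L # Ls)))"
    by (rule ext) (simp add: multilinear_expand[OF ml, of _ us "L _"])
  moreover have "(\<Sum>b\<in>Basis. inner (L 0) b *\<^sub>R ?G b + inner (D L) b *\<^sub>R H 0 (us @ b # ?W))
      = H' (us @ L 0 # ?W) + (\<Sum>l<length Ls. H 0 (us @ L 0 # ?W' l)) + H 0 (us @ D L # ?W)"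
  proof -
    have "(\<Sum>b\<in>Basis. inner (L 0) b *\<^sub>R (\<Sum>l<length Ls. H 0 (us @ b # ?W' l)))
        = (\<Sum>l<length Ls. \<Sum>b\<in>Basis. inner (L 0) b *\<^sub>R H 0 (us @ b # ?W' l))"
      by (subst sum.swap) (simp add: scaleR_sum_right)
    then show ?thesis
      by (simp only: scaleR_add_right sum.distrib multilinear_expand[OF ml, of 0 us "L 0"]
        multilinear_expand[OF ml, of 0 us "D L"] H'_expand[of "L 0"])
  qed
  ultimately show ?case
    by (simp add: sum.lessThan_Suc_shift add_ac del: sum.lessThan_Suc)
qed

text \<open>For s = -\<i> this is the complex-linear part of the differential at v, for s = \<i> the
  antilinear part. No coordinates are involved, so it behaves well under holomorphic maps, whose
  differentials commute with multiplication by \<i>.\<close>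

definition wirtinger :: "complex \<Rightarrow> complex^'i \<Rightarrow> (complex^'i::finite \<Rightarrow> complex) \<Rightarrow> complex^'i \<Rightarrow> complex" where
  "wirtinger s v f z = (dir_deriv f z v + s * dir_deriv f z (\<i> *s v)) / 2"

text \<open>Forms are evaluated on arbitrary vectors of the ambient type, while derivatives make
  sense only in directions of \<open>cspace I\<close>. The sums over \<open>I\<close> in
  \<open>del\<close> and \<open>delbar\<close> see just this projection.\<close>

definition cproj :: "'i set \<Rightarrow> complex^'i::finite \<Rightarrow> complex^'i" where
  "cproj I v = (\<chi> i. if i \<in> I then v $ i else 0)"

lemma cproj_in: "cproj I v \<in> cspace I"
  by (simp add: cproj_def cspace_def)

lemma cproj_id: "v \<in> cspace I \<Longrightarrow> cproj I v = v"
  by (simp add: cproj_def cspace_def Finite_Cartesian_Product.vec_eq_iff)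

lemma subspace_cspace: "subspace (cspace I)"
  by (rule subspaceI) (auto simp: cspace_def)

lemma cspace_scale: "v \<in> cspace I \<Longrightarrow> c *s v \<in> cspace I"
  by (simp add: cspace_def)

lemma axis_in_cspace: "i \<in> I \<Longrightarrow> axis i c \<in> cspace I"
  by (auto simp: cspace_def axis_def)

lemma bounded_linear_vector_scalar_mult: "bounded_linear (\<lambda>v :: complex^'i::finite. c *s v)"
proof -
  have "linear (\<lambda>v :: complex^'i. c *s v)"
    by (rule linearI) (auto simp: Finite_Cartesian_Product.vec_eq_iff algebra_simps)
  then show ?thesis by (simp add: linear_conv_bounded_linear)
qed

context open_in_subspace begin

lemma dir_deriv_bounded_linear:
  assumes h: "bounded_linear h" and f: "smooth_on S f" and z: "z \<in> S" and v: "v \<in> V"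
  shows "dir_deriv (\<lambda>w. h (f w)) z v = h (dir_deriv f z v)"
  unfolding dir_deriv_def[of "\<lambda>w. h (f w)"]
  by (rule vector_derivative_at) (rule bounded_linear.has_vector_derivative[OF h smooth_on_has_vector_derivative[OF f z v]])

lemma dir_deriv_add:
  assumes f: "smooth_on S f" and g: "smooth_on S g" and z: "z \<in> S" and v: "v \<in> V"
  shows "dir_deriv (\<lambda>w. f w + g w) z v = dir_deriv f z v + dir_deriv g z v"
  unfolding dir_deriv_def[of "\<lambda>w. f w + g w"]
  by (rule vector_derivative_at) (intro has_vector_derivative_add smooth_on_has_vector_derivative assms)

lemma dir_deriv_cong:
  assumes eq: "\<And>w. w \<in> S \<Longrightarrow> f w = g w" and f: "smooth_on S f" and z: "z \<in> S" and v: "v \<in> V"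
  shows "dir_deriv f z v = dir_deriv g z v"
proof -
  obtain f' where f': "(f has_derivative f') (at z within S)"
    using smooth_on_derivative_exists[OF f] z by blast
  then have "(g has_derivative f') (at z within S)"
    by (rule has_derivative_transform[OF z, rotated]) (simp add: eq)
  with f' show ?thesis using dir_deriv_eq z v by metis
qed

lemma dir_deriv_linear_on:
  assumes f: "smooth_on S f" and z: "z \<in> S"
  obtains f' where "linear f'" "\<And>v. v \<in> V \<Longrightarrow> dir_deriv f z v = f' v"
  using smooth_on_derivative_exists[OF f] has_derivative_linear dir_deriv_eq z by metis

end

locale open_in_cspace =
  fixes I :: "'i::finite set" and S :: "(complex^'i) set"
  assumes open_cspace: "openin (top_of_set (cspace I)) S"
begin

sublocale open_in_subspace "cspace I" S
  by unfold_locales (rule subspace_cspace, rule open_cspace)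

lemma smooth_on_wirtinger: "smooth_on S f \<Longrightarrow> v \<in> cspace I \<Longrightarrow> smooth_on S (wirtinger s v f)"
proof -
  assume f: "smooth_on S f" and v: "v \<in> cspace I"
  have "smooth_on S (\<lambda>z. (1/2) * (dir_deriv f z v + s * dir_deriv f z (\<i> *s v)))"
    by (intro smooth_on_mult_left smooth_on_add smooth_on_dir_deriv f v cspace_scale)
  then show ?thesis by (simp add: wirtinger_def[abs_def])
qed

lemma dir_deriv_mult_left:
  fixes f :: "complex^'i \<Rightarrow> complex"
  assumes "smooth_on S f" "z \<in> S" "v \<in> cspace I"
  shows "dir_deriv (\<lambda>w. c * f w) z v = c * dir_deriv f z v"
  by (rule dir_deriv_bounded_linear[OF bounded_linear_mult_right assms])

lemma wirtinger_add:
  assumes "smooth_on S f" "smooth_on S g" "z \<in> S" "v \<in> cspace I"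
  shows "wirtinger s v (\<lambda>w. f w + g w) z = wirtinger s v f z + wirtinger s v g z"
  using assms by (simp add: wirtinger_def dir_deriv_add cspace_scale algebra_simps add_divide_distrib)

lemma wirtinger_mult_left:
  assumes "smooth_on S f" "z \<in> S" "v \<in> cspace I"
  shows "wirtinger s v (\<lambda>w. c * f w) z = c * wirtinger s v f z"
  using assms by (simp add: wirtinger_def dir_deriv_mult_left cspace_scale algebra_simps)

lemma wirtinger_zero: "wirtinger s v (\<lambda>w. 0) z = 0"
  by (simp add: wirtinger_def dir_deriv_def)

lemma wirtinger_sum:
  assumes "\<And>k. k \<in> K \<Longrightarrow> smooth_on S (f k)" "z \<in> S" "v \<in> cspace I"
  shows "wirtinger s v (\<lambda>w. \<Sum>k\<in>K. f k w) z = (\<Sum>k\<in>K. wirtinger s v (f k) z)"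
  using assms(1)
  by (induction K rule: infinite_finite_induct)
    (auto simp: wirtinger_zero wirtinger_add[OF _ smooth_on_sum assms(2,3)])

lemma wirtinger_cong:
  assumes "\<And>w. w \<in> S \<Longrightarrow> f w = g w" "smooth_on S f" "z \<in> S" "v \<in> cspace I"
  shows "wirtinger s v f z = wirtinger s v g z"
  using dir_deriv_cong[of f g z v] dir_deriv_cong[of f g z "\<i> *s v"] assms
  by (simp add: wirtinger_def cspace_scale)

lemma wirtinger_commute:
  assumes f: "smooth_on S f" and z: "z \<in> S" and v: "v \<in> cspace I" and w: "w \<in> cspace I"
  shows "wirtinger s v (wirtinger t w f) z = wirtinger t w (wirtinger s v f) z"
proof -
  have expand: "dir_deriv (wirtinger t w f) z u =
      (dir_deriv (\<lambda>x. dir_deriv f x w) z u + t * dir_deriv (\<lambda>x. dir_deriv f x (\<i> *s w)) z u) / 2"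
    if w: "w \<in> cspace I" and u: "u \<in> cspace I" for t w u
  proof -
    have "wirtinger t w f = (\<lambda>x. (1/2) * (dir_deriv f x w + t * dir_deriv f x (\<i> *s w)))"
      by (simp add: wirtinger_def[abs_def])
    moreover have "dir_deriv (\<lambda>x. (1/2) * (dir_deriv f x w + t * dir_deriv f x (\<i> *s w))) z u
        = (1/2) * (dir_deriv (\<lambda>x. dir_deriv f x w) z u + t * dir_deriv (\<lambda>x. dir_deriv f x (\<i> *s w)) z u)"
      using f z u w by (subst dir_deriv_mult_left dir_deriv_add;
        simp add: smooth_on_add smooth_on_mult_left smooth_on_dir_deriv cspace_scale)+
    ultimately show ?thesis by simp
  qed
  note commute = dir_deriv_commute[OF f z]
  show ?thesis
    using v w by (simp add: wirtinger_def[of _ _ "wirtinger _ _ _"] expand cspace_scale commute[of w v]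
      commute[of w "\<i> *s v"] commute[of "\<i> *s w" v] commute[of "\<i> *s w" "\<i> *s v"])
      (simp add: algebra_simps add_divide_distrib)
qed

lemma sum_axis_derivative:
  fixes f :: "complex^'i \<Rightarrow> complex"
  assumes f: "smooth_on S f" and z: "z \<in> S"
  shows "dir_deriv f z (cproj I v) =
    (\<Sum>i\<in>I. Re (v $ i) * dir_deriv f z (axis i 1) + Im (v $ i) * dir_deriv f z (axis i \<i>))"
proof -
  obtain f' where lin: "linear f'" and f': "\<And>v. v \<in> cspace I \<Longrightarrow> dir_deriv f z v = f' v"
    using dir_deriv_linear_on[OF f z] by blast
  have "cproj I v = (\<Sum>i\<in>I. Re (v $ i) *\<^sub>R axis i 1 + Im (v $ i) *\<^sub>R axis i \<i>)"
  proof -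
    have "(\<Sum>i\<in>I. Re (v $ i) *\<^sub>R axis i 1 + Im (v $ i) *\<^sub>R axis i \<i>) $ j = cproj I v $ j" for j
    proof -
      have "(\<Sum>i\<in>I. Re (v $ i) *\<^sub>R axis i 1 + Im (v $ i) *\<^sub>R axis i \<i>) $ j
          = (\<Sum>i\<in>I. if i = j then v $ j else 0)"
        unfolding sum_component by (intro sum.cong) (auto simp: axis_def complex_eq_iff)
      then show ?thesis by (simp add: cproj_def)
    qed
    then show ?thesis by (simp add: Finite_Cartesian_Product.vec_eq_iff)
  qed
  then have "f' (cproj I v) = (\<Sum>i\<in>I. Re (v $ i) *\<^sub>R f' (axis i 1) + Im (v $ i) *\<^sub>R f' (axis i \<i>))"
    by (simp add: linear_sum[OF lin] linear_add[OF lin] linear_scale[OF lin])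
  then show ?thesis
    by (simp add: f' cproj_in axis_in_cspace scaleR_conv_of_real)
qed

text \<open>Bridge from the coordinate definition of the operators to the coordinate-free
  one.\<close>

lemma sum_d_dz:
  assumes f: "smooth_on S f" and z: "z \<in> S"
  shows "(\<Sum>i\<in>I. dz i v * d_dz i f z) = wirtinger (- \<i>) (cproj I v) f z"
    and "(\<Sum>i\<in>I. dzbar i v * d_dzbar i f z) = wirtinger \<i> (cproj I v) f z"
proof -
  let ?a = "\<lambda>i. dir_deriv f z (axis i 1)" and ?b = "\<lambda>i. dir_deriv f z (axis i \<i>)"
  have i: "\<i> *s cproj I v = cproj I (\<i> *s v)" by (simp add: cproj_def Finite_Cartesian_Product.vec_eq_iff)
  show "(\<Sum>i\<in>I. dz i v * d_dz i f z) = wirtinger (- \<i>) (cproj I v) f z"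
    unfolding wirtinger_def i sum_axis_derivative[OF f z] dz_def d_dz_def sum_distrib_left sum.distrib[symmetric] sum_divide_distrib
    by (rule sum.cong[OF refl]) (simp add: complex_eq_iff algebra_simps)
  show "(\<Sum>i\<in>I. dzbar i v * d_dzbar i f z) = wirtinger \<i> (cproj I v) f z"
    unfolding wirtinger_def i sum_axis_derivative[OF f z] dzbar_def d_dzbar_def sum_distrib_left sum.distrib[symmetric] sum_divide_distrib
    by (rule sum.cong[OF refl]) (simp add: complex_eq_iff algebra_simps)
qed

end

section \<open>Covectors of type \<open>(p,q)\<close>\<close>

lemma finite_pq_monomials: "finite (pq_monomials I p q)"
proof -
  let ?L = "\<lambda>m. {xs. set xs \<subseteq> I \<and> length xs = nat m}"
  have "pq_monomials I p q \<subseteq> (\<lambda>(is, js). wedge (map dz is @ map dzbar js)) ` (?L p \<times> ?L q)"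
    by (auto simp: pq_monomials_def image_iff)
  then show ?thesis by (rule finite_subset) (intro finite_imageI finite_cartesian_product finite_lists_length_eq finite)
qed

text \<open>Replaces the varying finite subsets by one fixed finite generating set, as
  differentiating along a curve of covectors requires.\<close>

lemma pq_covectors_eq_cspan: "pq_covectors I p q = cspan (pq_monomials I p q)"
proof (intro equalityI subsetI)
  fix \<alpha> assume "\<alpha> \<in> pq_covectors I p q"
  then obtain B a where B: "finite B" "B \<subseteq> pq_monomials I p q" "\<alpha> = (\<lambda>vs. \<Sum>\<beta>\<in>B. a \<beta> * \<beta> vs)"
    by (auto simp: pq_covectors_def)
  have "\<alpha> = (\<lambda>vs. \<Sum>\<beta>\<in>pq_monomials I p q. (if \<beta> \<in> B then a \<beta> else 0) * \<beta> vs)"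
    unfolding B(3) using B(2) finite_pq_monomials[of I p q]
    by (intro ext sum.mono_neutral_cong_left) auto
  then show "\<alpha> \<in> cspan (pq_monomials I p q)" unfolding cspan_def by (intro CollectI exI)
next
  fix \<alpha> assume "\<alpha> \<in> cspan (pq_monomials I p q)"
  then show "\<alpha> \<in> pq_covectors I p q"
    unfolding cspan_def pq_covectors_def using finite_pq_monomials[of I p q] by blast
qed

lemmas pq_covectors_closed =
  cspan_zero[of "pq_monomials I p q" for I p q, folded pq_covectors_eq_cspan]
  cspan_add[of _ "pq_monomials I p q" for I p q, folded pq_covectors_eq_cspan]
  cspan_scale[of _ "pq_monomials I p q" for I p q, folded pq_covectors_eq_cspan]
  cspan_sum[of _ _ "pq_monomials I p q" for I p q, folded pq_covectors_eq_cspan]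

lemma pq_covectors_induct [consumes 1, case_names monomial zero add scale]:
  assumes "\<alpha> \<in> pq_covectors I p q"
    and monomial: "\<And>is js. set is \<subseteq> I \<Longrightarrow> set js \<subseteq> I \<Longrightarrow> int (length is) = p \<Longrightarrow> int (length js) = q
      \<Longrightarrow> P (wedge (map dz is @ map dzbar js))"
    and zero: "P (\<lambda>vs. 0)"
    and add: "\<And>\<alpha> \<beta>. P \<alpha> \<Longrightarrow> P \<beta> \<Longrightarrow> P (\<lambda>vs. \<alpha> vs + \<beta> vs)"
    and scale: "\<And>a \<alpha>. P \<alpha> \<Longrightarrow> P (\<lambda>vs. a * \<alpha> vs)"
  shows "P \<alpha>"
proof -
  obtain B a where B: "finite B" "B \<subseteq> pq_monomials I p q" and \<alpha>: "\<alpha> = (\<lambda>vs. \<Sum>\<beta>\<in>B. a \<beta> * \<beta> vs)"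
    using assms(1) by (auto simp: pq_covectors_def)
  have "P (\<lambda>vs. \<Sum>\<beta>\<in>B. a \<beta> * \<beta> vs)" using B
  proof (induction B rule: finite_induct)
    case (insert \<beta> B)
    have "P \<beta>" using insert.prems monomial by (auto simp: pq_monomials_def)
    then have "P (\<lambda>vs. a \<beta> * \<beta> vs + (\<Sum>\<beta>\<in>B. a \<beta> * \<beta> vs))" using insert by (intro add scale) auto
    then show ?case using insert.hyps by simp
  qed (simp add: zero)
  then show ?thesis by (simp add: \<alpha>)
qed

lemma linear_dz: "linear (dz i)" and linear_dzbar: "linear (dzbar i)"
  by (auto intro!: linearI simp: dz_def dzbar_def)

lemma pq_covectors_multilinear: "\<alpha> \<in> pq_covectors I p q \<Longrightarrow> multilinear \<alpha>"
proof (induction rule: pq_covectors_induct)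
  case (monomial "is" js)
  show ?case by (rule multilinear_wedge) (auto simp: linear_dz linear_dzbar)
next
  case (scale a \<alpha>)
  then show ?case by (auto simp: multilinear_def linear_iff scaleR_conv_of_real algebra_simps)
qed (auto simp: multilinear_def linear_iff algebra_simps)

lemma pq_covectors_alternating: "\<alpha> \<in> pq_covectors I p q \<Longrightarrow> alternating \<alpha>"
proof (induction rule: pq_covectors_induct)
  case (monomial "is" js)
  show ?case by (rule alternating_wedge)
next
  case (add \<alpha> \<beta>)
  show ?case unfolding alternating_def
    using add[unfolded alternating_def] by (metis minus_add_distrib)
next
  case (scale a \<alpha>)
  show ?case unfolding alternating_def
    using scale[unfolded alternating_def] by (metis mult_minus_right)
qed (auto simp: alternating_def)

lemma pq_monomial_in:
  "set is \<subseteq> I \<Longrightarrow> set js \<subseteq> I \<Longrightarrow> wedge (map dz is @ map dzbar js) \<in> pq_covectors I (int (length is)) (int (length js))"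
  unfolding pq_covectors_eq_cspan by (rule cspan_base[OF finite_pq_monomials]) (auto simp: pq_monomials_def)

text \<open>Conjugation exchanges the two kinds of factors and leaves them in the wrong order;
  swapping the blocks costs only a sign.\<close>

lemma pq_covectors_cnj: "\<alpha> \<in> pq_covectors I p q \<Longrightarrow> (\<lambda>vs. cnj (\<alpha> vs)) \<in> pq_covectors I q p"
proof (induction rule: pq_covectors_induct)
  case (monomial "is" js)
  have "cnj (wedge (map dz is @ map dzbar js) vs) = wedge ([] @ map dzbar is @ map dz js) vs" for vs
    unfolding cnj_wedge by (simp add: comp_def dz_def[abs_def] dzbar_def[abs_def])
  also have "\<dots> vs = (-1) ^ (length is * length js) * wedge (map dz js @ map dzbar is) vs" for vs
    using alternating_swap_blocks[OF alternating_wedge_covectors, of "[]" "map dzbar is" "map dz js" vs] by simp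
  finally show ?case
    using pq_covectors_closed(3)[OF pq_monomial_in[OF monomial(2,1)], of "(-1) ^ (length is * length js)"] monomial(3,4)
    by simp
qed (auto simp: pq_covectors_closed)

lemma pq_covectors_dz_wedge:
  assumes i: "i \<in> I"
  shows "\<alpha> \<in> pq_covectors I p q \<Longrightarrow>
    (\<lambda>vs. \<Sum>j<length vs. (-1) ^ j * (dz i (vs ! j) * \<alpha> (omit j vs))) \<in> pq_covectors I (p + 1) q"
proof (induction rule: pq_covectors_induct)
  case (monomial "is" js)
  then show ?case using pq_monomial_in[of "i # is" I js] i
    by (simp add: wedge_Cons[symmetric] add.commute)
next
  case (add \<alpha> \<beta>)
  from pq_covectors_closed(2)[OF add] show ?case by (simp add: sum.distrib algebra_simps)
next
  case (scale a \<alpha>)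
  from pq_covectors_closed(3)[OF scale, of a] show ?case by (simp add: sum_distrib_left algebra_simps)
qed (simp add: pq_covectors_closed)

text \<open>The new factor stands in front of the holomorphic ones and must be moved past them to
  reach the order used in \<open>pq_monomials\<close>, hence the sign.\<close>

lemma pq_covectors_dzbar_wedge:
  assumes i: "i \<in> I"
  shows "\<alpha> \<in> pq_covectors I p q \<Longrightarrow>
    (\<lambda>vs. \<Sum>j<length vs. (-1) ^ j * (dzbar i (vs ! j) * \<alpha> (omit j vs))) \<in> pq_covectors I p (q + 1)"
proof (induction rule: pq_covectors_induct)
  case (monomial "is" js)
  have "wedge (dzbar i # map dz is @ map dzbar js) vs = (-1) ^ length is * wedge (map dz is @ map dzbar (i # js)) vs" for vs
    using alternating_move[OF alternating_wedge_covectors, of "[]" "dzbar i" "map dz is" "map dzbar js" vs] by simp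
  moreover have "wedge (map dz is @ map dzbar (i # js)) \<in> pq_covectors I p (q + 1)"
    using pq_monomial_in[of "is" I "i # js"] monomial i by (simp add: add.commute)
  ultimately show ?case
    using pq_covectors_closed(3)[of "wedge (map dz is @ map dzbar (i # js))" I p "q + 1" "(-1) ^ length is"]
    by (simp add: wedge_Cons[symmetric])
next
  case (add \<alpha> \<beta>)
  from pq_covectors_closed(2)[OF add] show ?case by (simp add: sum.distrib algebra_simps)
next
  case (scale a \<alpha>)
  from pq_covectors_closed(3)[OF scale, of a] show ?case by (simp add: sum_distrib_left algebra_simps)
qed (simp add: pq_covectors_closed)

text \<open>Too many factors of one kind force a repetition. Nonzero types therefore lie in a square
  with side \<open>card I\<close>, and its antidiagonals give the factor in the theorem.\<close>

lemma pq_covectors_eq_0: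
  assumes "p < 0 \<or> q < 0 \<or> int (card I) < p \<or> int (card I) < q"
  shows "\<alpha> \<in> pq_covectors I p q \<Longrightarrow> \<alpha> = (\<lambda>vs. 0)"
proof (induction rule: pq_covectors_induct)
  case (monomial "is" js)
  have "length xs \<le> card I" if "distinct xs" "set xs \<subseteq> I" for xs
    using that by (metis card_mono distinct_card finite)
  then have "\<not> distinct is \<or> \<not> distinct js" using assms monomial by force
  then have "\<not> distinct (map dz is @ map dzbar js)" by (auto simp: distinct_map)
  then show ?case by (intro ext wedge_eq_0_if_not_distinct)
qed auto

section \<open>Charts, transition maps and forms on the manifold\<close>

locale complex_manifold =
  fixes I :: "'i::finite set" and X :: "'a topology" and A :: "('a, 'i) chart set"
  assumes manifold: "compact_complex_manifold I X A"
begin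

lemma chart: "c \<in> A \<Longrightarrow> is_chart I X c"
  using manifold by (simp add: compact_complex_manifold_def)

lemma chart_range_open: "c \<in> A \<Longrightarrow> open_in_cspace I (chart_range c)"
  using chart[of c] by (simp add: open_in_cspace_def is_chart_def)

lemma overlap_open:
  assumes "c \<in> A" "d \<in> A" shows "open_in_cspace I (snd c ` (fst c \<inter> fst d))"
proof -
  have c: "openin X (fst c)" "openin (top_of_set (cspace I)) (chart_range c)"
    "homeomorphic_map (subtopology X (fst c)) (top_of_set (chart_range c)) (snd c)"
    using chart[OF assms(1)] by (auto simp: is_chart_def)
  have "openin (subtopology X (fst c)) (fst c \<inter> fst d)"
    using chart[OF assms(2)] by (auto simp: is_chart_def openin_subtopology_Int2)
  then have "openin (top_of_set (chart_range c)) (snd c ` (fst c \<inter> fst d))"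
    using homeomorphic_imp_open_map[OF c(3)] by (auto simp: open_map_def)
  then show ?thesis using openin_trans[OF _ c(2)] by (simp add: open_in_cspace_def)
qed

lemma transition_chart:
  assumes "c \<in> A" "x \<in> fst c" shows "transition c d (snd c x) = snd d x"
proof -
  have "homeomorphic_map (subtopology X (fst c)) (top_of_set (chart_range c)) (snd c)" "openin X (fst c)"
    using chart[OF assms(1)] by (auto simp: is_chart_def)
  then have "inj_on (snd c) (fst c)"
    using homeomorphic_imp_injective_map[of "subtopology X (fst c)"] openin_subset[of X "fst c"]
    by (simp add: topspace_subtopology Int_absorb1)
  then show ?thesis using assms(2) by (simp add: transition_def)
qed

lemma transition_holomorphic:
  "c \<in> A \<Longrightarrow> d \<in> A \<Longrightarrow> holomorphic_map_on (snd c ` (fst c \<inter> fst d)) (transition c d)"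
  using manifold by (simp add: compact_complex_manifold_def)

text \<open>The type condition holds at every z, since zero has every type. This matters when a line
  through a point leaves the chart range.\<close>

lemma formsD:
  assumes "\<omega> \<in> forms I A p q"
  shows "c \<in> A \<Longrightarrow> smooth_on (chart_range c) (\<lambda>z. \<omega> c z vs)"
    and "\<omega> c z \<in> pq_covectors I p q"
    and "c \<in> A \<Longrightarrow> d \<in> A \<Longrightarrow> x \<in> fst c \<Longrightarrow> x \<in> fst d \<Longrightarrow> set vs \<subseteq> cspace I \<Longrightarrow>
        \<omega> c (snd c x) vs = \<omega> d (snd d x) (map (dir_deriv (transition c d) (snd c x)) vs)"
    and "\<not> (c \<in> A \<and> z \<in> chart_range c) \<Longrightarrow> \<omega> c z vs = 0"
proof -
  show 0: "\<omega> c z vs = 0" if "\<not> (c \<in> A \<and> z \<in> chart_range c)" for c z vs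
    using assms that unfolding forms_def by blast
  show "\<omega> c z \<in> pq_covectors I p q"
  proof (cases "c \<in> A \<and> z \<in> chart_range c")
    case True
    then show ?thesis using assms unfolding forms_def by blast
  next
    case False
    then have "\<omega> c z = (\<lambda>vs. 0)" using 0 by blast
    then show ?thesis by (simp add: pq_covectors_closed)
  qed
  show "c \<in> A \<Longrightarrow> smooth_on (chart_range c) (\<lambda>z. \<omega> c z vs)"
    using assms unfolding forms_def by blast
  show "c \<in> A \<Longrightarrow> d \<in> A \<Longrightarrow> x \<in> fst c \<Longrightarrow> x \<in> fst d \<Longrightarrow> set vs \<subseteq> cspace I \<Longrightarrow>
        \<omega> c (snd c x) vs = \<omega> d (snd d x) (map (dir_deriv (transition c d) (snd c x)) vs)"
    using assms unfolding forms_def by blast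
qed

end

section \<open>The operators \<open>\<partial>\<close> and its conjugate on forms\<close>

text \<open>The operators \<open>\<partial>\<close> (for \<open>s = -\<i>\<close>) and its conjugate (for \<open>s = \<i>\<close>) in one formula.\<close>

definition dop :: "complex \<Rightarrow> 'i set \<Rightarrow> ('a, 'i::finite) chart set \<Rightarrow> ('a, 'i) form \<Rightarrow> ('a, 'i) form" where
  "dop s I A \<omega> = (\<lambda>c z vs.
     if c \<in> A \<and> z \<in> chart_range c
     then \<Sum>j<length vs. (-1) ^ j * wirtinger s (cproj I (vs ! j)) (\<lambda>w. \<omega> c w (omit j vs)) z
     else 0)"

context complex_manifold begin

lemma dop_eq:
  assumes \<omega>: "\<omega> \<in> forms I A p q"
  shows "del I A \<omega> = dop (- \<i>) I A \<omega>" "delbar I A \<omega> = dop \<i> I A \<omega>"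
proof -
  have "del I A \<omega> c z vs = dop (- \<i>) I A \<omega> c z vs" "delbar I A \<omega> c z vs = dop \<i> I A \<omega> c z vs" for c z vs
  proof -
    show "del I A \<omega> c z vs = dop (- \<i>) I A \<omega> c z vs"
    proof (cases "c \<in> A \<and> z \<in> chart_range c")
      case True
      then interpret S: open_in_cspace I "chart_range c" by (simp add: chart_range_open)
      show ?thesis using True
        by (simp add: del_def dop_def omit_def[symmetric] S.sum_d_dz[OF formsD(1)[OF \<omega>]])
    qed (auto simp: del_def dop_def)
    show "delbar I A \<omega> c z vs = dop \<i> I A \<omega> c z vs"
    proof (cases "c \<in> A \<and> z \<in> chart_range c")
      case True
      then interpret S: open_in_cspace I "chart_range c" by (simp add: chart_range_open)
      show ?thesis using True
        by (simp add: delbar_def dop_def omit_def[symmetric] S.sum_d_dz[OF formsD(1)[OF \<omega>]])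
    qed (auto simp: delbar_def dop_def)
  qed
  then show "del I A \<omega> = dop (- \<i>) I A \<omega>" "delbar I A \<omega> = dop \<i> I A \<omega>" by blast+
qed

lemma dop_smooth:
  assumes \<omega>: "\<omega> \<in> forms I A p q" and c: "c \<in> A"
  shows "smooth_on (chart_range c) (\<lambda>z. dop s I A \<omega> c z vs)"
proof -
  interpret S: open_in_cspace I "chart_range c" by (rule chart_range_open[OF c])
  have "smooth_on (chart_range c) (\<lambda>z. \<Sum>j<length vs. (-1) ^ j * wirtinger s (cproj I (vs ! j)) (\<lambda>w. \<omega> c w (omit j vs)) z)"
    by (intro smooth_on_sum smooth_on_mult_left S.smooth_on_wirtinger cproj_in formsD(1)[OF \<omega>] c)
  then show ?thesis
    by (rule iffD1[OF smooth_on_cong, rotated]) (simp add: dop_def c)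
qed

lemma dir_deriv_in_pq_covectors:
  assumes \<omega>: "\<omega> \<in> forms I A p q" and c: "c \<in> A" and z: "z \<in> chart_range c" and v: "v \<in> cspace I"
  shows "(\<lambda>vs. dir_deriv (\<lambda>w. \<omega> c w vs) z v) \<in> pq_covectors I p q"
proof -
  interpret S: open_in_cspace I "chart_range c" by (rule chart_range_open[OF c])
  show ?thesis unfolding pq_covectors_eq_cspan
  proof (rule cspan_derivative[OF finite_pq_monomials])
    show "\<omega> c (z + t *\<^sub>R v) \<in> cspan (pq_monomials I p q)" for t
      using formsD(2)[OF \<omega>] by (simp add: pq_covectors_eq_cspan)
    show "((\<lambda>t. \<omega> c (z + t *\<^sub>R v) vs) has_vector_derivative dir_deriv (\<lambda>w. \<omega> c w vs) z v) (at 0)" for vs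
      by (rule S.smooth_on_has_vector_derivative[OF formsD(1)[OF \<omega> c] z v])
  qed
qed

lemma del_type:
  assumes \<omega>: "\<omega> \<in> forms I A p q" and c: "c \<in> A" and z: "z \<in> chart_range c"
  shows "del I A \<omega> c z \<in> pq_covectors I (p + 1) q"
proof -
  have "(\<lambda>vs. d_dz i (\<lambda>w. \<omega> c w vs) z) \<in> pq_covectors I p q" if i: "i \<in> I" for i
  proof -
    have "(\<lambda>vs. (1/2) * (dir_deriv (\<lambda>w. \<omega> c w vs) z (axis i 1) + (-\<i>) * dir_deriv (\<lambda>w. \<omega> c w vs) z (axis i \<i>)))
        \<in> pq_covectors I p q"
      by (intro pq_covectors_closed dir_deriv_in_pq_covectors[OF \<omega> c z] axis_in_cspace i)
    then show ?thesis by (simp add: d_dz_def)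
  qed
  then have "(\<lambda>vs. \<Sum>i\<in>I. \<Sum>j<length vs. (-1) ^ j * (dz i (vs ! j) * d_dz i (\<lambda>w. \<omega> c w (omit j vs)) z))
      \<in> pq_covectors I (p + 1) q"
    by (intro pq_covectors_closed(4) pq_covectors_dz_wedge)
  also have "(\<lambda>vs. \<Sum>i\<in>I. \<Sum>j<length vs. (-1) ^ j * (dz i (vs ! j) * d_dz i (\<lambda>w. \<omega> c w (omit j vs)) z)) = del I A \<omega> c z"
    using c z by (intro ext, subst sum.swap) (simp add: del_def omit_def sum_distrib_left)
  finally show ?thesis .
qed

lemma delbar_type:
  assumes \<omega>: "\<omega> \<in> forms I A p q" and c: "c \<in> A" and z: "z \<in> chart_range c"
  shows "delbar I A \<omega> c z \<in> pq_covectors I p (q + 1)"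
proof -
  have "(\<lambda>vs. d_dzbar i (\<lambda>w. \<omega> c w vs) z) \<in> pq_covectors I p q" if i: "i \<in> I" for i
  proof -
    have "(\<lambda>vs. (1/2) * (dir_deriv (\<lambda>w. \<omega> c w vs) z (axis i 1) + \<i> * dir_deriv (\<lambda>w. \<omega> c w vs) z (axis i \<i>)))
        \<in> pq_covectors I p q"
      by (intro pq_covectors_closed dir_deriv_in_pq_covectors[OF \<omega> c z] axis_in_cspace i)
    then show ?thesis by (simp add: d_dzbar_def)
  qed
  then have "(\<lambda>vs. \<Sum>i\<in>I. \<Sum>j<length vs. (-1) ^ j * (dzbar i (vs ! j) * d_dzbar i (\<lambda>w. \<omega> c w (omit j vs)) z))
      \<in> pq_covectors I p (q + 1)"
    by (intro pq_covectors_closed(4) pq_covectors_dzbar_wedge)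
  also have "(\<lambda>vs. \<Sum>i\<in>I. \<Sum>j<length vs. (-1) ^ j * (dzbar i (vs ! j) * d_dzbar i (\<lambda>w. \<omega> c w (omit j vs)) z)) = delbar I A \<omega> c z"
    using c z by (intro ext, subst sum.swap) (simp add: delbar_def omit_def sum_distrib_left)
  finally show ?thesis .
qed

text \<open>Both orders are added because exchanging two removals also exchanges s and t. The case s
  = t says that twice the square vanishes, the case of \<i> and -\<i> is anticommutation.\<close>

lemma dop_dop:
  assumes \<omega>: "\<omega> \<in> forms I A p q"
  shows "dop s I A (dop t I A \<omega>) c z vs + dop t I A (dop s I A \<omega>) c z vs = 0"
proof (cases "c \<in> A \<and> z \<in> chart_range c")
  case False
  then show ?thesis by (auto simp: dop_def)
next
  case True
  then have c: "c \<in> A" and z: "z \<in> chart_range c" by auto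
  interpret S: open_in_cspace I "chart_range c" by (rule chart_range_open[OF c])
  let ?f = "\<lambda>us w. \<omega> c w us"
  have sm: "smooth_on (chart_range c) (?f us)" for us by (rule formsD(1)[OF \<omega> c])
  let ?n = "length vs"
  let ?g = "\<lambda>s t j l. (-1) ^ (j + l) * wirtinger s (cproj I (vs ! j))
      (wirtinger t (cproj I (omit j vs ! l)) (?f (omit l (omit j vs)))) z"
  have expand: "dop s I A (dop t I A \<omega>) c z vs = (\<Sum>j<?n. \<Sum>l<?n - 1. ?g s t j l)" for s t
  proof -
    have "wirtinger s v (\<lambda>w. dop t I A \<omega> c w us) z
        = (\<Sum>l<length us. (-1) ^ l * wirtinger s v (wirtinger t (cproj I (us ! l)) (?f (omit l us))) z)"
      if v: "v \<in> cspace I" for v us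
    proof -
      have "wirtinger s v (\<lambda>w. dop t I A \<omega> c w us) z
        = wirtinger s v (\<lambda>w. \<Sum>l<length us. (-1) ^ l * wirtinger t (cproj I (us ! l)) (?f (omit l us)) w) z"
        by (rule S.wirtinger_cong[OF _ dop_smooth[OF \<omega> c] z v]) (simp add: dop_def c)
      also have "\<dots> = (\<Sum>l<length us. wirtinger s v (\<lambda>w. (-1) ^ l * wirtinger t (cproj I (us ! l)) (?f (omit l us)) w) z)"
        by (intro S.wirtinger_sum z v smooth_on_mult_left S.smooth_on_wirtinger sm cproj_in)
      also have "\<dots> = (\<Sum>l<length us. (-1) ^ l * wirtinger s v (wirtinger t (cproj I (us ! l)) (?f (omit l us))) z)"
        by (intro sum.cong refl S.wirtinger_mult_left z v S.smooth_on_wirtinger sm cproj_in)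
      finally show ?thesis .
    qed
    note w = this[OF cproj_in]
    have "dop s I A (dop t I A \<omega>) c z vs =
        (\<Sum>j<?n. (-1) ^ j * wirtinger s (cproj I (vs ! j)) (\<lambda>w. dop t I A \<omega> c w (omit j vs)) z)"
      unfolding dop_def[of s] using c z by simp
    also have "\<dots> = (\<Sum>j<?n. \<Sum>l<?n - 1. ?g s t j l)"
      by (rule sum.cong[OF refl])
        (simp add: w length_omit sum_distrib_left power_add mult.assoc)
    finally show ?thesis .
  qed
  \<comment> \<open>The term of \<open>?g s t\<close> at (b, a) cancels that of
    \<open>?g t s\<close> at (a, b - 1): the derivatives commute and the signs are opposite.\<close>
  have "(\<Sum>j<?n. \<Sum>l<?n - 1. ?g s t j l + ?g t s j l) = 0"
  proof (rule double_removal_sum_eq_0)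
    fix a b assume ab: "a < b" "b < ?n"
    obtain xs x ys y zs where vs: "vs = xs @ x # ys @ y # zs" and a: "length xs = a" and b: "length ys = b - a - 1"
      using split_list_at_two[OF ab] .
    have b': "length xs + length ys + 1 = b" using a b ab by simp
    note o = omit_two[where xs = xs and x = x and ys = ys and y = y and zs = zs, folded vs, unfolded b', unfolded a]
    have sgn: "(-1) ^ (b + a) = - ((-1) ^ (a + (b - 1)) :: complex)"
    proof -
      have "b + a = Suc (a + (b - 1))" using ab by simp
      then show ?thesis by (simp only: power_Suc) simp
    qed
    let ?F = "?f (xs @ ys @ zs)"
    have "wirtinger s (cproj I y) (wirtinger t (cproj I x) ?F) z = wirtinger t (cproj I x) (wirtinger s (cproj I y) ?F) z" for s t
      by (rule S.wirtinger_commute[OF sm z cproj_in cproj_in])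
    then show "(?g s t b a + ?g t s b a) + (?g s t a (b - 1) + ?g t s a (b - 1)) = 0"
      unfolding o(3-8) sgn by (simp add: algebra_simps)
  qed
  then show ?thesis by (simp only: expand sum.distrib)
qed

section \<open>Pullback of forms along a transition map\<close>

context
  fixes c d :: "('a, 'i) chart" and S T
  assumes c: "c \<in> A" and d: "d \<in> A"
  defines "S \<equiv> snd c ` (fst c \<inter> fst d)" and "T \<equiv> transition c d"
begin

interpretation S: open_in_cspace I S
  unfolding S_def by (rule overlap_open[OF c d])

interpretation R: open_in_cspace I "chart_range d"
  by (rule chart_range_open[OF d])

lemma transition_in: "z \<in> S \<Longrightarrow> T z \<in> chart_range d"
  unfolding S_def T_def using transition_chart[OF c, of _ d] by auto

lemma transition_smooth: "smooth_on S T"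
  using transition_holomorphic[OF c d] by (simp add: holomorphic_map_on_def S_def T_def)

lemma dir_deriv_transition_line:
  assumes z: "z \<in> S" and v: "v \<in> cspace I"
  shows "((\<lambda>t. T (z + t *\<^sub>R v)) has_vector_derivative dir_deriv T z v) (at 0)"
  by (rule S.smooth_on_has_vector_derivative[OF transition_smooth z v])

lemma dir_deriv_transition_in:
  assumes z: "z \<in> S" and v: "v \<in> cspace I"
  shows "dir_deriv T z v \<in> cspace I"
proof -
  have "dir_deriv T z v $ i = 0" if i: "i \<notin> I" for i
  proof -
    have "dir_deriv (\<lambda>w. T w $ i) z v = dir_deriv T z v $ i"
      by (rule S.dir_deriv_bounded_linear[OF bounded_linear_vec_nth transition_smooth z v])
    \<comment> \<open>Components outside \<open>I\<close> vanish identically on the overlap, because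
      the transition map takes values in \<open>cspace I\<close>.\<close>
    moreover have "dir_deriv (\<lambda>w. 0) z v = dir_deriv (\<lambda>w. T w $ i) z v"
      by (rule S.dir_deriv_cong[OF _ smooth_on_zero z v])
        (use transition_in R.in_V i in \<open>auto simp: cspace_def\<close>)
    ultimately show ?thesis by (simp add: dir_deriv_def)
  qed
  then show ?thesis by (simp add: cspace_def)
qed

lemma dir_deriv_transition_scale:
  assumes z: "z \<in> S" and v: "v \<in> cspace I"
  shows "dir_deriv T z (a *s v) = a *s dir_deriv T z v"
proof -
  obtain L where "(T has_derivative L) (at z within S)" "\<forall>c v. L (c *s v) = c *s L v"
    using transition_holomorphic[OF c d] z unfolding holomorphic_map_on_def S_def T_def by blast
  then show ?thesis using S.dir_deriv_eq z v cspace_scale by metis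
qed

definition hessian :: "complex^'i \<Rightarrow> complex^'i \<Rightarrow> complex^'i \<Rightarrow> complex^'i" where
  "hessian z v w = dir_deriv (\<lambda>y. dir_deriv T y w) z v"

lemma hessian_commute:
  "z \<in> S \<Longrightarrow> v \<in> cspace I \<Longrightarrow> w \<in> cspace I \<Longrightarrow> hessian z v w = hessian z w v"
  unfolding hessian_def by (rule S.dir_deriv_commute[OF transition_smooth])

text \<open>Holomorphy gives complex linearity in the argument of the differential; symmetry of
  second derivatives transfers it to the direction of differentiation.\<close>

lemma hessian_scale:
  assumes z: "z \<in> S" and v: "v \<in> cspace I" and w: "w \<in> cspace I"
  shows "hessian z (a *s v) w = a *s hessian z v w"
proof -
  have sm: "smooth_on S (\<lambda>y. dir_deriv T y v)" by (rule S.smooth_on_dir_deriv[OF transition_smooth v])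
  have "hessian z (a *s v) w = hessian z w (a *s v)"
    by (rule hessian_commute[OF z cspace_scale[OF v] w])
  also have "\<dots> = dir_deriv (\<lambda>y. a *s dir_deriv T y v) z w"
    unfolding hessian_def
    by (rule S.dir_deriv_cong[OF dir_deriv_transition_scale[OF _ v] S.smooth_on_dir_deriv[OF transition_smooth cspace_scale[OF v]] z w])
  also have "\<dots> = a *s hessian z w v"
    unfolding hessian_def by (rule S.dir_deriv_bounded_linear[OF bounded_linear_vector_scalar_mult sm z w])
  also have "hessian z w v = hessian z v w" by (rule hessian_commute[OF z w v])
  finally show ?thesis .
qed

text \<open>Moving along v moves both the base point \<open>T z\<close>, which gives the first-order
  term, and every argument of the pulled-back form, which gives one Hessian term each.\<close>

lemma form_dir_deriv_transition:
  assumes \<omega>: "\<omega> \<in> forms I A p q" and z: "z \<in> S" and v: "v \<in> cspace I" and ws: "set ws \<subseteq> cspace I"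
  shows "dir_deriv (\<lambda>w. \<omega> c w ws) z v =
    dir_deriv (\<lambda>w. \<omega> d w (map (dir_deriv T z) ws)) (T z) (dir_deriv T z v)
    + (\<Sum>l<length ws. \<omega> d (T z) ((map (dir_deriv T z) ws)[l := hessian z v (ws ! l)]))"
    (is "_ = ?X + ?Y")
proof -
  let ?Ls = "map (\<lambda>w t. dir_deriv T (z + t *\<^sub>R v) w) ws"
  let ?F = "\<lambda>t. \<omega> d (T (z + t *\<^sub>R v)) (map (\<lambda>w. dir_deriv T (z + t *\<^sub>R v) w) ws)"
  have ev: "\<forall>\<^sub>F t in nhds (0::real). z + t *\<^sub>R v \<in> S" by (rule S.eventually_line_in[OF z v])
  have "((\<lambda>t. \<omega> d (T (z + t *\<^sub>R v)) ([] @ map (\<lambda>L. L t) ?Ls)) has_vector_derivative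
      dir_deriv (\<lambda>w. \<omega> d w ([] @ map (\<lambda>L. L 0) ?Ls)) (T z) (dir_deriv T z v)
      + (\<Sum>l<length ?Ls. \<omega> d (T (z + 0 *\<^sub>R v)) ([] @ (map (\<lambda>L. L 0) ?Ls)[l := vector_derivative (?Ls ! l) (at 0)]))) (at 0)"
  proof (rule has_vector_derivative_multilinear)
    show "multilinear (\<omega> d (T (z + t *\<^sub>R v)))" for t
      by (rule pq_covectors_multilinear[OF formsD(2)[OF \<omega>]])
    show "((\<lambda>t. \<omega> d (T (z + t *\<^sub>R v)) us) has_vector_derivative
        dir_deriv (\<lambda>w. \<omega> d w us) (T z) (dir_deriv T z v)) (at 0)" for us
    proof -
      have Tz: "T z \<in> chart_range d" by (rule transition_in[OF z])
      obtain f' where f': "((\<lambda>w. \<omega> d w us) has_derivative f') (at (T z) within chart_range d)"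
        using smooth_on_derivative_exists[OF formsD(1)[OF \<omega> d]] Tz by metis
      have "((\<lambda>t. \<omega> d (T (z + t *\<^sub>R v)) us) has_vector_derivative f' (dir_deriv T z v)) (at 0)"
      proof (rule R.has_vector_derivative_curve)
        show "((\<lambda>w. \<omega> d w us) has_derivative f') (at (T (z + 0 *\<^sub>R v)) within chart_range d)" using f' by simp
        show "\<forall>\<^sub>F t in nhds 0. T (z + t *\<^sub>R v) \<in> chart_range d"
          using ev by eventually_elim (rule transition_in)
      qed (rule dir_deriv_transition_line[OF z v])
      moreover have "f' (dir_deriv T z v) = dir_deriv (\<lambda>w. \<omega> d w us) (T z) (dir_deriv T z v)"
        by (rule R.dir_deriv_eq[symmetric, OF f' Tz dir_deriv_transition_in[OF z v]])
      ultimately show ?thesis by simp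
    qed
    show "(L has_vector_derivative vector_derivative L (at 0)) (at 0)" if L: "L \<in> set ?Ls" for L
    proof -
      obtain w where w: "w \<in> cspace I" "L = (\<lambda>t. dir_deriv T (z + t *\<^sub>R v) w)"
        using L ws by auto
      show ?thesis unfolding w(2)
        using S.smooth_on_has_vector_derivative[OF S.smooth_on_dir_deriv[OF transition_smooth w(1)] z v]
        by (simp add: dir_deriv_def)
    qed
  qed
  also have "(\<lambda>t. \<omega> d (T (z + t *\<^sub>R v)) ([] @ map (\<lambda>L. L t) ?Ls)) = ?F"
    by (simp add: comp_def)
  also have "dir_deriv (\<lambda>w. \<omega> d w ([] @ map (\<lambda>L. L 0) ?Ls)) (T z) (dir_deriv T z v) = ?X"
    by (simp add: comp_def)
  also have "(\<Sum>l<length ?Ls. \<omega> d (T (z + 0 *\<^sub>R v)) ([] @ (map (\<lambda>L. L 0) ?Ls)[l := vector_derivative (?Ls ! l) (at 0)])) = ?Y"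
    by (simp add: comp_def hessian_def dir_deriv_def[of "\<lambda>y. dir_deriv T y _"])
  finally have F: "(?F has_vector_derivative ?X + ?Y) (at 0)" .
  have evF: "\<forall>\<^sub>F t in nhds (0::real). ?F t = \<omega> c (z + t *\<^sub>R v) ws"
    using ev
  proof eventually_elim
    case (elim t)
    then obtain x where x: "x \<in> fst c" "x \<in> fst d" "z + t *\<^sub>R v = snd c x" by (auto simp: S_def)
    then show ?case
      using formsD(3)[OF \<omega> c d x(1,2) ws] transition_chart[OF c x(1), of d] by (simp add: T_def)
  qed
  have "((\<lambda>t. \<omega> c (z + t *\<^sub>R v) ws) has_vector_derivative ?X + ?Y) (at 0)"
    unfolding has_vector_derivative_def
  proof (rule has_derivative_transform_eventually[OF F[unfolded has_vector_derivative_def]])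
    show "\<forall>\<^sub>F t in at (0::real). ?F t = \<omega> c (z + t *\<^sub>R v) ws"
      unfolding eventually_at_filter using evF by (rule eventually_mono) simp
    show "?F 0 = \<omega> c (z + 0 *\<^sub>R v) ws" by (rule eventually_nhds_x_imp_x[OF evF])
  qed simp
  then show ?thesis unfolding dir_deriv_def[of "\<lambda>w. \<omega> c w ws"] by (rule vector_derivative_at)
qed

text \<open>The second-order terms of the pullback cancel because the Hessian of the transition map is symmetric
  and the form is alternating. They are multiplied by \<open>\<i>\<close> when \<open>v\<close> is, so this holds for the two
  halves of \<open>d\<close> separately.\<close>

lemma dop_transition:
  assumes \<omega>: "\<omega> \<in> forms I A p q" and z: "z \<in> S" and vs: "set vs \<subseteq> cspace I"
  shows "dop s I A \<omega> c z vs = dop s I A \<omega> d (T z) (map (dir_deriv T z) vs)"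
proof -
  let ?n = "length vs" and ?D = "dir_deriv T z"
  have zc: "z \<in> chart_range c" using z by (auto simp: S_def)
  have alt: "alternating (\<omega> d (T z))" by (rule pq_covectors_alternating[OF formsD(2)[OF \<omega>]])
  let ?K = "\<lambda>a v ws. \<Sum>l<length ws. \<omega> d (T z) ((map ?D ws)[l := hessian z (a *s v) (ws ! l)])"
  have w: "wirtinger s v (\<lambda>w. \<omega> c w ws) z =
      wirtinger s (?D v) (\<lambda>w. \<omega> d w (map ?D ws)) (T z) + (?K 1 v ws + s * ?K \<i> v ws) / 2"
    if v: "v \<in> cspace I" and ws: "set ws \<subseteq> cspace I" for v ws
    unfolding wirtinger_def form_dir_deriv_transition[OF \<omega> z v ws]
      form_dir_deriv_transition[OF \<omega> z cspace_scale[OF v] ws]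
    using dir_deriv_transition_scale[OF z v, of \<i>]
    by (simp add: algebra_simps add_divide_distrib)
  have cancel: "(\<Sum>j<?n. (-1) ^ j * ?K a (vs ! j) (omit j vs)) = 0" for a
  proof -
    have "(\<Sum>j<?n. (-1) ^ j * (\<Sum>l<?n - 1. \<omega> d (T z) ((map ?D (omit j vs))[l := hessian z (a *s (vs ! j)) (omit j vs ! l)]))) = 0"
    proof (rule symmetric_insertion_sum_eq_0[OF alt, where B = "\<lambda>v w. hessian z (a *s v) w"])
      show "hessian z (a *s v) w = hessian z (a *s w) v" if "v \<in> set vs" "w \<in> set vs" for v w
        using that vs hessian_scale[OF z] hessian_commute[OF z] by (metis subsetD)
    qed
    then show ?thesis by (simp add: length_omit)
  qed
  have in_c: "vs ! j \<in> cspace I" "set (omit j vs) \<subseteq> cspace I" if "j < ?n" for j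
    using that vs set_omit[of j vs] by auto
  have "dop s I A \<omega> c z vs = (\<Sum>j<?n. (-1) ^ j * wirtinger s (vs ! j) (\<lambda>w. \<omega> c w (omit j vs)) z)"
    using c zc in_c(1) by (simp add: dop_def cproj_id)
  also have "\<dots> = (\<Sum>j<?n. (-1) ^ j * wirtinger s (?D (vs ! j)) (\<lambda>w. \<omega> d w (map ?D (omit j vs))) (T z)
      + ((-1) ^ j * ?K 1 (vs ! j) (omit j vs) + s * ((-1) ^ j * ?K \<i> (vs ! j) (omit j vs))) / 2)"
    by (rule sum.cong[OF refl]) (simp add: w in_c algebra_simps add_divide_distrib)
  also have "\<dots> = (\<Sum>j<?n. (-1) ^ j * wirtinger s (?D (vs ! j)) (\<lambda>w. \<omega> d w (map ?D (omit j vs))) (T z))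
      + ((\<Sum>j<?n. (-1) ^ j * ?K 1 (vs ! j) (omit j vs)) + s * (\<Sum>j<?n. (-1) ^ j * ?K \<i> (vs ! j) (omit j vs))) / 2"
    by (simp only: sum.distrib sum_divide_distrib[symmetric] sum_distrib_left[symmetric])
  also have "\<dots> = (\<Sum>j<?n. (-1) ^ j * wirtinger s (?D (vs ! j)) (\<lambda>w. \<omega> d w (map ?D (omit j vs))) (T z))"
    unfolding cancel by simp
  also have "\<dots> = dop s I A \<omega> d (T z) (map ?D vs)"
    using d transition_in[OF z] in_c(1) dir_deriv_transition_in[OF z]
    by (simp add: dop_def cproj_id map_omit)
  finally show ?thesis .
qed

end

lemma formsI:
  assumes "\<And>c z. c \<in> A \<Longrightarrow> z \<in> chart_range c \<Longrightarrow> \<omega> c z \<in> pq_covectors I p q"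
    and "\<And>c vs. c \<in> A \<Longrightarrow> smooth_on (chart_range c) (\<lambda>z. \<omega> c z vs)"
    and "\<And>c d x vs. c \<in> A \<Longrightarrow> d \<in> A \<Longrightarrow> x \<in> fst c \<Longrightarrow> x \<in> fst d \<Longrightarrow> set vs \<subseteq> cspace I \<Longrightarrow>
        \<omega> c (snd c x) vs = \<omega> d (snd d x) (map (dir_deriv (transition c d) (snd c x)) vs)"
    and "\<And>c z vs. \<not> (c \<in> A \<and> z \<in> chart_range c) \<Longrightarrow> \<omega> c z vs = 0"
  shows "\<omega> \<in> forms I A p q"
  unfolding forms_def using assms by blast

text \<open>The resulting bidegree depends on s, so it enters as a hypothesis; invariance under
  change of charts is the same for both operators.\<close>

lemma dop_in_forms:
  assumes \<omega>: "\<omega> \<in> forms I A p q"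
    and type: "\<And>c z. c \<in> A \<Longrightarrow> z \<in> chart_range c \<Longrightarrow> dop s I A \<omega> c z \<in> pq_covectors I p' q'"
  shows "dop s I A \<omega> \<in> forms I A p' q'"
proof (rule formsI)
  fix c d x vs assume *: "c \<in> A" "d \<in> A" "x \<in> fst c" "x \<in> fst d" "set vs \<subseteq> cspace I"
  then have "snd c x \<in> snd c ` (fst c \<inter> fst d)" by auto
  from dop_transition[OF *(1,2) \<omega> this *(5), of s]
  show "dop s I A \<omega> c (snd c x) vs = dop s I A \<omega> d (snd d x) (map (dir_deriv (transition c d) (snd c x)) vs)"
    by (simp add: transition_chart[OF *(1,3)])
qed (use type dop_smooth[OF \<omega>] in \<open>auto simp: dop_def\<close>)

lemma del_in_forms: "\<omega> \<in> forms I A p q \<Longrightarrow> del I A \<omega> \<in> forms I A (p + 1) q"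
  using dop_in_forms[of \<omega> p q "- \<i>" "p + 1" q] del_type[of \<omega> p q] by (simp add: dop_eq)

lemma delbar_in_forms: "\<omega> \<in> forms I A p q \<Longrightarrow> delbar I A \<omega> \<in> forms I A p (q + 1)"
  using dop_in_forms[of \<omega> p q "\<i>" p "q + 1"] delbar_type[of \<omega> p q] by (simp add: dop_eq)

end

section \<open>The double complex of forms\<close>

definition cscale :: "complex \<Rightarrow> ('a, 'i::finite) form \<Rightarrow> ('a, 'i) form" where
  "cscale a \<omega> = (\<lambda>c z vs. a * \<omega> c z vs)"

definition cnj_form :: "('a, 'i::finite) form \<Rightarrow> ('a, 'i) form" where
  "cnj_form \<omega> = (\<lambda>c z vs. cnj (\<omega> c z vs))"

lemma cnj_form_cnj_form: "cnj_form (cnj_form \<omega>) = \<omega>"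
  by (simp add: cnj_form_def)

interpretation forms: quotient_dimension cscale
  by unfold_locales (auto simp: cscale_def fun_eq_iff algebra_simps)

lemma zero_form_eq: "zero_form = 0"
  by (simp add: zero_fun_def)

lemma sum_cscale: "(\<Sum>\<omega>\<in>B. cscale (a \<omega>) \<omega>) = (\<lambda>c z vs. \<Sum>\<omega>\<in>B. a \<omega> * \<omega> c z vs)"
  by (induction B rule: infinite_finite_induct) (simp_all add: cscale_def fun_eq_iff)

lemma quot_dim_eq_qdim: "quot_dim Z W = forms.qdim Z W"
proof -
  have "{B. finite B \<and> B \<subseteq> Z \<and> (\<forall>a. (\<lambda>c z vs. \<Sum>\<omega>\<in>B. a \<omega> * \<omega> c z vs) \<in> W \<longrightarrow> (\<forall>\<omega>\<in>B. a \<omega> = 0))}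
      = {B. B \<subseteq> Z \<and> forms.independent_mod W B}"
    by (auto simp: forms.independent_mod_def sum_cscale)
  then show ?thesis by (simp add: quot_dim_def forms.qdim_def)
qed

context complex_manifold begin

lemma zero_in_forms: "0 \<in> forms I A p q"
  unfolding zero_form_eq[symmetric] by (rule formsI) (simp_all add: smooth_on_zero pq_covectors_closed)

lemma add_in_forms:
  assumes \<omega>: "\<omega> \<in> forms I A p q" and \<eta>: "\<eta> \<in> forms I A p q"
  shows "\<omega> + \<eta> \<in> forms I A p q"
  unfolding plus_fun_def
proof (rule formsI)
  fix c d x vs assume *: "c \<in> A" "d \<in> A" "x \<in> fst c" "x \<in> fst d" "set vs \<subseteq> cspace I"
  show "\<omega> c (snd c x) vs + \<eta> c (snd c x) vs =
    \<omega> d (snd d x) (map (dir_deriv (transition c d) (snd c x)) vs) + \<eta> d (snd d x) (map (dir_deriv (transition c d) (snd c x)) vs)"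
    by (simp only: formsD(3)[OF \<omega> *] formsD(3)[OF \<eta> *])
qed (auto intro!: smooth_on_add pq_covectors_closed formsD(1,2)[OF \<omega>] formsD(1,2)[OF \<eta>]
    simp: formsD(4)[OF \<omega>] formsD(4)[OF \<eta>])

lemma cscale_in_forms:
  assumes \<omega>: "\<omega> \<in> forms I A p q"
  shows "cscale a \<omega> \<in> forms I A p q"
  unfolding cscale_def
proof (rule formsI)
  fix c d x vs assume *: "c \<in> A" "d \<in> A" "x \<in> fst c" "x \<in> fst d" "set vs \<subseteq> cspace I"
  show "a * \<omega> c (snd c x) vs = a * \<omega> d (snd d x) (map (dir_deriv (transition c d) (snd c x)) vs)"
    by (simp only: formsD(3)[OF \<omega> *])
qed (auto intro!: smooth_on_mult_left pq_covectors_closed formsD(1,2)[OF \<omega>] simp: formsD(4)[OF \<omega>])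

lemma cnj_in_forms:
  assumes \<omega>: "\<omega> \<in> forms I A p q"
  shows "cnj_form \<omega> \<in> forms I A q p"
  unfolding cnj_form_def
proof (rule formsI)
  fix c d x vs assume *: "c \<in> A" "d \<in> A" "x \<in> fst c" "x \<in> fst d" "set vs \<subseteq> cspace I"
  show "cnj (\<omega> c (snd c x) vs) = cnj (\<omega> d (snd d x) (map (dir_deriv (transition c d) (snd c x)) vs))"
    by (simp only: formsD(3)[OF \<omega> *])
qed (auto intro!: smooth_on_bounded_linear[OF bounded_linear_cnj] pq_covectors_cnj formsD(1,2)[OF \<omega>]
    simp: formsD(4)[OF \<omega>])

lemma dop_add:
  assumes "\<omega> \<in> forms I A p q" "\<eta> \<in> forms I A p q"
  shows "dop s I A (\<omega> + \<eta>) = dop s I A \<omega> + dop s I A \<eta>"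
proof (intro ext)
  fix c z vs
  show "dop s I A (\<omega> + \<eta>) c z vs = (dop s I A \<omega> + dop s I A \<eta>) c z vs"
  proof (cases "c \<in> A \<and> z \<in> chart_range c")
    case True
    then interpret S: open_in_cspace I "chart_range c" by (simp add: chart_range_open)
    show ?thesis using True formsD(1)[OF assms(1)] formsD(1)[OF assms(2)]
      by (simp add: dop_def S.wirtinger_add cproj_in sum.distrib algebra_simps)
  qed (auto simp: dop_def)
qed

lemma dop_cscale:
  assumes "\<omega> \<in> forms I A p q"
  shows "dop s I A (cscale a \<omega>) = cscale a (dop s I A \<omega>)"
proof (intro ext)
  fix c z vs
  show "dop s I A (cscale a \<omega>) c z vs = cscale a (dop s I A \<omega>) c z vs"
  proof (cases "c \<in> A \<and> z \<in> chart_range c")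
    case True
    then interpret S: open_in_cspace I "chart_range c" by (simp add: chart_range_open)
    show ?thesis using True formsD(1)[OF assms(1)]
      by (simp add: dop_def cscale_def S.wirtinger_mult_left cproj_in sum_distrib_left algebra_simps)
  qed (auto simp: dop_def cscale_def)
qed

lemma delbar_cnj_form:
  assumes \<omega>: "\<omega> \<in> forms I A p q"
  shows "delbar I A (cnj_form \<omega>) = cnj_form (del I A \<omega>)"
  unfolding dop_eq(1)[OF \<omega>] dop_eq(2)[OF cnj_in_forms[OF \<omega>]]
proof (intro ext)
  fix c z vs
  show "dop \<i> I A (cnj_form \<omega>) c z vs = cnj_form (dop (- \<i>) I A \<omega>) c z vs"
  proof (cases "c \<in> A \<and> z \<in> chart_range c")
    case True
    then interpret S: open_in_cspace I "chart_range c" by (simp add: chart_range_open)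
    have "wirtinger \<i> v (\<lambda>w. cnj (\<omega> c w us)) z = cnj (wirtinger (- \<i>) v (\<lambda>w. \<omega> c w us) z)"
      if v: "v \<in> cspace I" for v us
      using True v formsD(1)[OF \<omega>]
      by (simp add: wirtinger_def S.dir_deriv_bounded_linear[OF bounded_linear_cnj] cspace_scale)
    then show ?thesis using True by (simp add: dop_def cnj_form_def cproj_in)
  qed (auto simp: dop_def cnj_form_def)
qed

lemma del_cnj_form:
  assumes "\<omega> \<in> forms I A p q"
  shows "del I A (cnj_form \<omega>) = cnj_form (delbar I A \<omega>)"
  using delbar_cnj_form[OF cnj_in_forms[OF assms]] by (metis cnj_form_cnj_form)

text \<open>The laws are claimed on each space of forms only, as directional derivatives are linear
  and commute on smooth functions, not on arbitrary families.\<close>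

sublocale dc: double_complex cscale "forms I A" "del I A" "delbar I A"
proof unfold_locales
  fix p q \<omega> \<eta> a assume \<omega>: "\<omega> \<in> forms I A p q"
  show "del I A \<omega> \<in> forms I A (p + 1) q" "delbar I A \<omega> \<in> forms I A p (q + 1)"
    using \<omega> by (rule del_in_forms, rule delbar_in_forms)
  show "del I A (cscale a \<omega>) = cscale a (del I A \<omega>)" "delbar I A (cscale a \<omega>) = cscale a (delbar I A \<omega>)"
    by (simp_all add: dop_eq[OF \<omega>] dop_eq[OF cscale_in_forms[OF \<omega>]] dop_cscale[OF \<omega>])
  note eqs = dop_eq[OF \<omega>] dop_eq[OF del_in_forms[OF \<omega>], unfolded dop_eq[OF \<omega>]]
    dop_eq[OF delbar_in_forms[OF \<omega>], unfolded dop_eq[OF \<omega>]]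
  have "dop s I A (dop t I A \<omega>) = - dop t I A (dop s I A \<omega>)" for s t
    using dop_dop[OF \<omega>, of s t] by (intro ext) (simp add: eq_neg_iff_add_eq_0)
  from this[of "\<i>" "- \<i>"] show "delbar I A (del I A \<omega>) = - del I A (delbar I A \<omega>)" by (simp only: eqs)
  have "dop s I A (dop s I A \<omega>) = 0" for s
    using dop_dop[OF \<omega>, of s s] by (intro ext) simp
  then show "del I A (del I A \<omega>) = 0" "delbar I A (delbar I A \<omega>) = 0" by (simp_all add: eqs)
next
  fix p q \<omega> \<eta> assume \<omega>: "\<omega> \<in> forms I A p q" and \<eta>: "\<eta> \<in> forms I A p q"
  show "del I A (\<omega> + \<eta>) = del I A \<omega> + del I A \<eta>" "delbar I A (\<omega> + \<eta>) = delbar I A \<omega> + delbar I A \<eta>"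
    by (simp_all add: dop_eq[OF \<omega>] dop_eq[OF \<eta>] dop_eq[OF add_in_forms[OF \<omega> \<eta>]] dop_add[OF \<omega> \<eta>])
next
  show "forms.subspace (forms I A p q)" for p q
    by (rule forms.subspaceI) (simp_all add: zero_in_forms add_in_forms cscale_in_forms)
qed

lemma dims_eq:
  "dim_Dolbeault I A p q = dc.h_d' p q"
  "dim_BottChern I A p q = dc.h_BC p q"
  "dim_Aeppli I A p q = dc.h_A p q"
  by (simp_all add: dim_Dolbeault_def dim_BottChern_def dim_Aeppli_def dc.h_d'_def dc.h_BC_def dc.h_A_def
    quot_dim_eq_qdim zero_form_eq plus_fun_def)

text \<open>Conjugation is antilinear, so the twist is \<open>cnj\<close>; it exchanges the two
  operators and the two degrees.\<close>

lemma h_d_le_conjugate: "dc.h_d p q \<le> dc.h_d' q p"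
  unfolding dc.h_d_def dc.h_d'_def
proof (rule forms.qdim_le_relation[where R = "\<lambda>x y. x \<in> forms I A p q \<and> y = cnj_form x" and \<tau> = cnj])
  have zero: "cnj_form 0 = 0" by (simp add: cnj_form_def fun_eq_iff)
  show "\<exists>y\<in>{x \<in> forms I A q p. delbar I A x = 0}. x \<in> forms I A p q \<and> y = cnj_form x"
    if "x \<in> {x \<in> forms I A p q. del I A x = 0}" for x
    using that by (auto simp: cnj_in_forms delbar_cnj_form zero)
  show "0 \<in> forms I A p q \<and> 0 = cnj_form 0" by (simp add: zero_in_forms zero)
  show "x + x' \<in> forms I A p q \<and> y + y' = cnj_form (x + x')"
    if "x \<in> forms I A p q \<and> y = cnj_form x" "x' \<in> forms I A p q \<and> y' = cnj_form x'" for x y x' y'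
    using that by (auto simp: add_in_forms cnj_form_def fun_eq_iff)
  show "cscale (cnj a) x \<in> forms I A p q \<and> cscale a y = cnj_form (cscale (cnj a) x)"
    if "x \<in> forms I A p q \<and> y = cnj_form x" for a x y
    using that cscale_in_forms[of x p q "cnj a"] by (simp add: cnj_form_def cscale_def)
  show "x \<in> del I A ` forms I A (p - 1) q"
    if xy: "x \<in> forms I A p q \<and> y = cnj_form x" "y \<in> delbar I A ` forms I A q (p - 1)" for x y
  proof -
    obtain u where u: "u \<in> forms I A q (p - 1)" "cnj_form x = delbar I A u" using xy by auto
    then have "x = del I A (cnj_form u)" by (metis del_cnj_form cnj_form_cnj_form)
    then show ?thesis using cnj_in_forms[OF u(1)] by blast
  qed
  show "0 \<in> delbar I A ` forms I A q (p - 1)" using zero_in_forms dc.d'_zero by force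
qed auto

lemma forms_eq_0:
  assumes "p < 0 \<or> q < 0 \<or> int (card I) < p \<or> int (card I) < q"
  shows "forms I A p q \<subseteq> {0}"
proof
  fix \<omega> assume "\<omega> \<in> forms I A p q"
  then have "\<omega> c z = (\<lambda>vs. 0)" for c z by (rule pq_covectors_eq_0[OF assms formsD(2)])
  then show "\<omega> \<in> {0}" by (simp add: fun_eq_iff)
qed

section \<open>Summation along a total degree\<close>

definition total_h :: "int \<Rightarrow> enat" where
  "total_h k = (\<Sum>p=0..k. dc.h_d' p (k - p))"

text \<open>Injectivity of \<open>f\<close> ensures that each Dolbeault number of total degree k is
  used at most once.\<close>

lemma sum_le_total:
  assumes inj: "inj_on f J" and J: "finite J" and f: "\<And>i. i \<in> J \<Longrightarrow> x i \<le> dc.h_d' (f i) (k - f i)"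
  shows "(\<Sum>i\<in>J. x i) \<le> total_h k"
proof -
  have "(\<Sum>i\<in>J. x i) \<le> (\<Sum>i\<in>J. dc.h_d' (f i) (k - f i))" by (rule sum_mono[OF f])
  also have "\<dots> = (\<Sum>p\<in>f ` J. dc.h_d' p (k - p))" by (simp add: sum.reindex inj)
  \<comment> \<open>Outside 0..k one of the two degrees is negative and the term vanishes, so
    \<open>f\<close> may leave the range.\<close>
  also have "\<dots> = (\<Sum>p\<in>f ` J \<inter> {0..k}. dc.h_d' p (k - p))"
    by (rule sum.mono_neutral_right) (use J in \<open>auto intro!: dc.h_d'_eq_0 forms_eq_0\<close>)
  also have "\<dots> \<le> total_h k" unfolding total_h_def by (rule sum_mono2) auto
  finally show ?thesis .
qed

lemma h_A_le_total:
  assumes "p \<le> k" shows "dc.h_A p (k - p) \<le> total_h k + total_h (k + 1)"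
proof -
  \<comment> \<open>One step more than the second degree k - p, so that the iteration ends in second
    degree -1, where the remainder vanishes.\<close>
  define m where "m = nat (k - p + 1)"
  have m: "int m = k - p + 1" using assms by (simp add: m_def)
  have "dc.h_A (p + int m) (k - p - int m) = 0" by (rule dc.h_A_eq_0[OF forms_eq_0]) (simp add: m)
  then have "dc.h_A p (k - p) \<le> (\<Sum>i<m. dc.h_d' (p + int i + 1) (k - p - int i)) + (\<Sum>i<m. dc.h_d (p + int i) (k - p - int i))"
    using dc.h_A_le_iterate[of p "k - p" m] by simp
  also have "\<dots> \<le> total_h (k + 1) + total_h k"
  proof (rule add_mono)
    show "(\<Sum>i<m. dc.h_d' (p + int i + 1) (k - p - int i)) \<le> total_h (k + 1)"
      by (rule sum_le_total[where f = "\<lambda>i. p + int i + 1"]) (auto simp: inj_on_def algebra_simps)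
    show "(\<Sum>i<m. dc.h_d (p + int i) (k - p - int i)) \<le> total_h k"
      \<comment> \<open>Conjugation swaps the degrees, so the second degree becomes the summation
        index.\<close>
      by (rule sum_le_total[where f = "\<lambda>i. k - p - int i"])
        (use h_d_le_conjugate in \<open>auto simp: inj_on_def algebra_simps\<close>)
  qed
  finally show ?thesis by (simp add: add.commute)
qed

lemma h_BC_le_total:
  assumes "p \<le> k" shows "dc.h_BC p (k - p) \<le> total_h k + total_h (k - 1)"
proof -
  define m where "m = nat (k - p + 1)"
  have m: "int m = k - p + 1" using assms by (simp add: m_def)
  have "dc.h_BC (p + int m) (k - p - int m) = 0" by (rule dc.h_BC_eq_0[OF forms_eq_0]) (simp add: m)
  then have "dc.h_BC p (k - p) \<le> (\<Sum>i<m. dc.h_d' (p + int i) (k - p - int i)) + (\<Sum>i<m. dc.h_d (p + int i) (k - p - int i - 1))"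
    using dc.h_BC_le_iterate[of p "k - p" m] by simp
  also have "\<dots> \<le> total_h k + total_h (k - 1)"
  proof (rule add_mono)
    show "(\<Sum>i<m. dc.h_d' (p + int i) (k - p - int i)) \<le> total_h k"
      by (rule sum_le_total[where f = "\<lambda>i. p + int i"]) (auto simp: inj_on_def algebra_simps)
    show "(\<Sum>i<m. dc.h_d (p + int i) (k - p - int i - 1)) \<le> total_h (k - 1)"
      \<comment> \<open>The last index is -1 and contributes zero.\<close>
      by (rule sum_le_total[where f = "\<lambda>i. k - p - int i - 1"])
        (use h_d_le_conjugate in \<open>auto simp: inj_on_def algebra_simps\<close>)
  qed
  finally show ?thesis .
qed

lemma total_eq_0: "k < 0 \<or> 2 * int (card I) < k \<Longrightarrow> total_h k = 0"
  unfolding total_h_def by (rule sum.neutral) (auto intro!: dc.h_d'_eq_0 forms_eq_0)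

lemma h_Dolbeault_eq: "h_Dolbeault I A k = ereal_of_enat (total_h k)"
  by (simp add: h_Dolbeault_def total_h_def dims_eq)

text \<open>Outside 0..2n, with n the dimension, the factor c may be negative. There the right-hand
  side must vanish, which \<open>outside\<close> secures: either c = 0 or both totals are
  zero.\<close>

lemma sum_bidegrees_le:
  assumes zero: "\<And>p. forms I A p (k - p) \<subseteq> {0} \<Longrightarrow> f p = (0::enat)"
    and le: "\<And>p. p \<le> k \<Longrightarrow> f p \<le> total_h k + total_h l"
    and outside: "k < 0 \<or> 2 * int (card I) < k \<Longrightarrow> c = 0 \<or> total_h l = 0"
    and c: "c = min (k + 1) (2 * int (card I) - k + 1)"
  shows "ereal_of_enat (\<Sum>p=0..k. f p) \<le> ereal (of_int c) * (h_Dolbeault I A k + h_Dolbeault I A l)"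
proof (cases "k < 0 \<or> 2 * int (card I) < k")
  case True
  then have 1: "(\<Sum>p=0..k. f p) = 0" by (intro sum.neutral) (auto intro!: zero forms_eq_0)
  have 2: "ereal (of_int c) * (h_Dolbeault I A k + h_Dolbeault I A l) = 0"
    using outside[OF True] total_eq_0[OF True] by (auto simp: h_Dolbeault_eq)
  show ?thesis unfolding 1 2 by simp
next
  case False
  \<comment> \<open>The values of p for which both p and k - p lie between 0 and n. There are k + 1
    of them if k \<le> n, and 2n - k + 1 otherwise.\<close>
  let ?J = "{max 0 (k - int (card I))..min k (int (card I))}"
  have card: "int (card ?J) = c" using False by (auto simp: c)
  have "(\<Sum>p=0..k. f p) = (\<Sum>p\<in>?J. f p)"
    by (rule sum.mono_neutral_right) (auto intro!: zero forms_eq_0)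
  also have "\<dots> \<le> of_nat (card ?J) * (total_h k + total_h l)"
    by (rule sum_bounded_above) (use le in auto)
  finally have "ereal_of_enat (\<Sum>p=0..k. f p) \<le> ereal_of_enat (of_nat (card ?J) * (total_h k + total_h l))"
    by simp
  also have "\<dots> = ereal (of_int c) * (h_Dolbeault I A k + h_Dolbeault I A l)"
    unfolding card[symmetric] by (simp add: ereal_of_enat_mult ereal_of_enat_add h_Dolbeault_eq of_nat_eq_enat)
  finally show ?thesis .
qed

end

theorem theorem2p2:
  fixes I :: "'i::finite set" and X :: "'a topology" and A :: "('a, 'i) chart set"
    and n :: nat and k :: int
  assumes "compact_complex_manifold I X A" and "card I = n"
  shows "h_Aeppli I A k
           \<le> ereal (of_int (min (k + 1) ((2 * int n - k) + 1)))
              * (h_Dolbeault I A k + h_Dolbeault I A (k + 1))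
       \<and> ereal (of_int (min (k + 1) ((2 * int n - k) + 1)))
              * (h_Dolbeault I A k + h_Dolbeault I A (k + 1))
           \<le> ereal (of_nat (n + 1)) * (h_Dolbeault I A k + h_Dolbeault I A (k + 1))
       \<and> h_BottChern I A k
           \<le> ereal (of_int (min (k + 1) ((2 * int n - k) + 1)))
              * (h_Dolbeault I A k + h_Dolbeault I A (k - 1))
       \<and> ereal (of_int (min (k + 1) ((2 * int n - k) + 1)))
              * (h_Dolbeault I A k + h_Dolbeault I A (k - 1))
           \<le> ereal (of_nat (n + 1)) * (h_Dolbeault I A k + h_Dolbeault I A (k - 1))"
proof -
  interpret complex_manifold I X A by unfold_locales (rule assms)
  define c where "c = min (k + 1) (2 * int (card I) - k + 1)"
  \<comment> \<open>A minimum is at most the mean of its two entries, and these add up to 2n +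
    2.\<close>
  have "of_int c \<le> (of_nat (n + 1) :: real)" using assms(2) by (simp add: c_def)
  then have upper: "ereal (of_int c) * (h_Dolbeault I A k + h_Dolbeault I A l)
      \<le> ereal (of_nat (n + 1)) * (h_Dolbeault I A k + h_Dolbeault I A l)" for l
    by (intro ereal_mult_right_mono) (auto simp: h_Dolbeault_eq)
  \<comment> \<open>Only k = -1 and k = 2n + 1 lie outside the range with a neighbour inside it, and
    there c = 0.\<close>
  have outside: "c = 0 \<or> total_h (k + 1) = 0" "c = 0 \<or> total_h (k - 1) = 0" if "k < 0 \<or> 2 * int (card I) < k"
    using that total_eq_0[of "k + 1"] total_eq_0[of "k - 1"]
    by (cases "k = -1"; cases "k = 2 * int (card I) + 1"; auto simp: c_def)+
  have "h_Aeppli I A k \<le> ereal (of_int c) * (h_Dolbeault I A k + h_Dolbeault I A (k + 1))"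
    unfolding h_Aeppli_def dims_eq
    by (rule sum_bidegrees_le[OF dc.h_A_eq_0 h_A_le_total outside(1) c_def]) auto
  moreover have "h_BottChern I A k \<le> ereal (of_int c) * (h_Dolbeault I A k + h_Dolbeault I A (k - 1))"
    unfolding h_BottChern_def dims_eq
    by (rule sum_bidegrees_le[OF dc.h_BC_eq_0 h_BC_le_total outside(2) c_def]) auto
  ultimately show ?thesis using upper assms(2) by (simp add: c_def)
qed

end
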